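(* Let $\mathcal{Q}$ be a set of noncommutative polynomials in $\mathbb{C}\langle Z_{i,j}\rangle$, and let $\mathbf{A}=(A_1,\ldots,A_k)\in B(\mathcal{H})^{n_1}\times_c\cdots\times_cB(\mathcal{H})^{n_k}$, $A_i=(A_{i,1},\ldots,A_{i,n_i})$, be such that each $\sum_{\alpha\in\mathbb{F}_{n_i}^+}a_{i,\alpha}A_{i,\alpha}A_{i,\alpha}^*$ is weakly convergent and $q(\mathbf{A})=0$ for any $q\in\mathcal{Q}$. Then the following statements are equivalent. (i) There is a tuple $\mathbf{T}=(T_1,\ldots,T_k)$, $T_i=(T_{i,1},\ldots,T_{i,n_i})$, in the noncommutative variety $\mathcal{V}_{\mathcal{Q}}(\mathcal{H})$ such that $\Phi_{f_i,T_i}(I)=I$ for $i\in\{1,\ldots,k\}$, and an invertible operator $Y\in B(\mathcal{H})$ such that $A_{i,j}=Y^{-1}T_{i,j}Y$ for all $i\in\{1,\ldots,k\}$ and $j\in\{1,\ldots,n_i\}$. (ii) There exist constants $0<c\leq d$ such that $$cI\leq\Phi_{f_1,A_1}^{s_1}\circ\cdots\circ\Phi_{f_k,A_k}^{s_k}(I)\leq dI,\qquad s_1,\ldots,s_k\in\mathbb{Z}_+.$$ (iii) There exist constants $0<c\leq d$ such that $$cI\leq\frac{1}{p^{(1)}\cdots p^{(k)}}\sum_{s_k=0}^{p^{(k)}-1}\cdots\sum_{s_1=0}^{p^{(1)}-1}\Phi_{f_k,A_k}^{s_k}\circ\cdots\circ\Phi_{f_1,A_1}^{s_1}(I)\leq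 dI$$ for any $p^{(1)},\ldots,p^{(k)}\in\mathbb{N}$. (iv) There is a positive invertible operator $Q\in B(\mathcal{H})$ such that $\Phi_{f_i,A_i}(Q)=Q$ for any $i\in\{1,\ldots,k\}$. Moreover, the operator $Q$ in (iv) can be chosen in the von Neumann algebra generated by $\{A_{i,j}\}$ and the identity and such that $cI\leq Q\leq dI$, where $c,d$ are the constants in (ii) or (iii).
   Context: $\mathcal{H}$ is a separable complex Hilbert space; $\mathbb{N}=\{1,2,\ldots\}$, $\mathbb{Z}_+=\{0,1,\ldots\}$; $n_i,m_i\in\mathbb{N}$, $\mathbf{m}=(m_1,\ldots,m_k)$. Order on $\mathbb{Z}_+^k$ is coordinatewise. $\mathbb{F}_{n_i}^+$ is the free monoid on generators $g_1^i,\ldots,g_{n_i}^i$ with identity $g_0^i$; $|\alpha|$ is word length. For an $n_i$-tuple $(X_{i,1},\ldots,X_{i,n_i})$ and $\alpha=g^i_{j_1}\cdots g^i_{j_p}$, $X_{i,\alpha}:=X_{i,j_1}\cdots X_{i,j_p}$, $X_{i,g_0^i}:=I$. $\mathbf{f}=(f_1,\ldots,f_k)$, where each $f_i=\sum_{\alpha\in\mathbb{F}_{n_i}^+}a_{i,\alpha}Z_{i,\alpha}$ is a positive regular free holomorphic function: a formal power series in noncommuting $Z_{i,1},\ldots,Z_{i,n_i}$ with $a_{i,\alpha}\ge0$, $a_{i,g_0^i}=0$, $a_{i,g_j^i}>0$ for $j=1,\ldots,n_i$, and $\limsup_{p\to\infty}(\sum_{|\alpha|=p}|a_{i,\alpha}|^2)^{1/2p}<\infty$.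 $\mathbb{C}\langle Z_{i,j}\rangle$ is the algebra of polynomials in $Z_{i,j}$ ($1\le i\le k$, $1\le j\le n_i$) where $Z_{s,j}$ and $Z_{t,l}$ commute for $s\neq t$ and are otherwise noncommuting. $B(\mathcal{H})^{n_1}\times_c\cdots\times_cB(\mathcal{H})^{n_k}$ is the set of tuples $\mathbf{X}=(X_1,\ldots,X_k)$, $X_i=(X_{i,1},\ldots,X_{i,n_i})$, such that for $s\ne t$ the entries of $X_s$ commute with those of $X_t$. $\Phi_{f_i,X_i}$ is well-defined if $\sum_\alpha a_{i,\alpha}X_{i,\alpha}X_{i,\alpha}^*$ converges in the weak operator topology (WOT); then $\Phi_{f_i,X_i}(Y):=\sum_\alpha a_{i,\alpha}X_{i,\alpha}YX_{i,\alpha}^*$ (WOT). $\mathbf{\Delta}_{\mathbf{f},\mathbf{X}}^{\mathbf{p}}:=(id-\Phi_{f_1,X_1})^{p_1}\circ\cdots\circ(id-\Phi_{f_k,X_k})^{p_k}$. $\mathbf{D}_{\mathbf{f}}^{\mathbf{m}}(\mathcal{H})$ is the set of $\mathbf{X}\in B(\mathcal{H})^{n_1}\times_c\cdots\times_cB(\mathcal{H})^{n_k}$ with $\Phi_{f_i,X_i}$ well-defined and $\mathbf{\Delta}_{\mathbf{f},\mathbf{X}}^{\mathbf{p}}(I)\ge0$ for $0\le\mathbf{p}\le\mathbf{m}$. $\mathcal{V}_{\mathcal{Q}}(\mathcal{H}):=\{\mathbf{X}\in\mathbf{D}_{\mathbf{f}}^{\mathbf{m}}(\mathcal{H}):g(\mathbf{X})=0\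 \forall g\in\mathcal{Q}\}$. *)

theory Defs
  imports "HOL-Analysis.Analysis" "HOL-Library.Poly_Mapping"
begin

section \<open>Complex Hilbert spaces\<close>

class complex_vector = real_vector +
  fixes scaleC :: "complex \<Rightarrow> 'a \<Rightarrow> 'a"  (infixr "*\<^sub>C" 75)
  assumes scaleC_add_right: "c *\<^sub>C (x + y) = c *\<^sub>C x + c *\<^sub>C y"
    and scaleC_add_left: "(c + d) *\<^sub>C x = c *\<^sub>C x + d *\<^sub>C x"
    and scaleC_scaleC: "c *\<^sub>C d *\<^sub>C x = (c * d) *\<^sub>C x"
    and scaleC_of_real: "complex_of_real r *\<^sub>C x = r *\<^sub>R x"

text \<open>The inner product is linear in the first and conjugate linear in the second argument.
  Positive definiteness is contained in the last axiom.\<close>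

class complex_hilbert_space = banach + complex_vector +
  fixes cinner :: "'a \<Rightarrow> 'a \<Rightarrow> complex"
  assumes cinner_commute: "cinner x y = cnj (cinner y x)"
    and cinner_add_left: "cinner (x + y) z = cinner x z + cinner y z"
    and cinner_scaleC_left: "cinner (c *\<^sub>C x) y = c * cinner x y"
    and cinner_self: "cinner x x = complex_of_real ((norm x)\<^sup>2)"

instantiation complex :: complex_hilbert_space
begin
definition scaleC_complex :: "complex \<Rightarrow> complex \<Rightarrow> complex" where "scaleC_complex = (*)"
definition cinner_complex :: "complex \<Rightarrow> complex \<Rightarrow> complex" where "cinner_complex x y = x * cnj y"
instance
proof
  fix x :: complex
  show "cinner x x = complex_of_real ((norm x)\<^sup>2)"
    unfolding cinner_complex_def by (rule complex_norm_square[symmetric])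
qed (simp_all add: scaleC_complex_def cinner_complex_def distrib_left distrib_right
    scaleR_conv_of_real)
end

lemma cinner_diff_left:
  "cinner (x - y) z = cinner x z - cinner (y :: 'a::complex_hilbert_space) z"
  by (metis add_diff_cancel_right' cinner_add_left diff_add_cancel)

lemma cinner_add_right:
  "cinner x (y + z) = cinner x y + cinner x (z :: 'a::complex_hilbert_space)"
  by (metis cinner_add_left cinner_commute complex_cnj_add)

lemma cinner_scaleC_right:
  "cinner x (c *\<^sub>C y) = cnj c * cinner x (y :: 'a::complex_hilbert_space)"
  by (metis cinner_commute cinner_scaleC_left complex_cnj_mult)

lemma cinner_zero_left [simp]: "cinner 0 (y :: 'a::complex_hilbert_space) = 0"
  using cinner_diff_left[of y y y] by simp

lemma scaleC_zero_right [simp]: "c *\<^sub>C (0 :: 'a::complex_vector) = 0"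
  using scaleC_add_right[of c 0 "0 :: 'a"] by simp

lemma scaleC_diff_right: "c *\<^sub>C (x - y) = c *\<^sub>C x - c *\<^sub>C (y :: 'a::complex_vector)"
  using scaleC_add_right[of c "x - y" y] by simp

lemma scaleC_minus_right: "c *\<^sub>C (- x) = - (c *\<^sub>C (x :: 'a::complex_vector))"
  using scaleC_diff_right[of c 0 x] by simp

lemma scaleC_scaleR_commute: "c *\<^sub>C r *\<^sub>R x = r *\<^sub>R c *\<^sub>C (x :: 'a::complex_vector)"
  by (simp add: scaleC_of_real[symmetric] scaleC_scaleC mult.commute)

lemma norm_scaleC: "norm (c *\<^sub>C (x :: 'a::complex_hilbert_space)) = cmod c * norm x"
proof -
  have "complex_of_real ((norm (c *\<^sub>C x))\<^sup>2) = c * cnj c * complex_of_real ((norm x)\<^sup>2)"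
    by (simp only: cinner_self[symmetric] cinner_scaleC_left cinner_scaleC_right
        mult.assoc mult.left_commute[of "cnj c"])
  also have "\<dots> = complex_of_real ((cmod c * norm x)\<^sup>2)"
    by (simp only: complex_norm_square[symmetric] power_mult_distrib of_real_mult)
  finally have "(norm (c *\<^sub>C x))\<^sup>2 = (cmod c * norm x)\<^sup>2"
    by (simp only: of_real_eq_iff)
  then show ?thesis by (rule power2_eq_imp_eq) simp_all
qed

lemma bounded_linear_scaleC:
  "bounded_linear (\<lambda>x. c *\<^sub>C (x :: 'a::complex_hilbert_space))"
  by (rule bounded_linear_intro[where K = "cmod c"])
    (simp_all add: scaleC_add_right scaleC_scaleR_commute norm_scaleC mult.commute)


section \<open>The algebra of bounded operators\<close>

typedef (overloaded) 'h bop =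
  "{T :: 'h::complex_hilbert_space \<Rightarrow> 'h.
      bounded_linear T \<and> (\<forall>c x. T (c *\<^sub>C x) = c *\<^sub>C T x)}"
  morphisms bop_apply Abs_bop
  by (rule exI[of _ "\<lambda>_. 0"]) simp

setup_lifting type_definition_bop

lemma bop_apply_add: "bop_apply T (x + y) = bop_apply T x + bop_apply T y"
  using bop_apply[of T] by (simp add: linear_simps)

lemma bop_apply_scaleC: "bop_apply T (c *\<^sub>C x) = c *\<^sub>C bop_apply T x"
  using bop_apply[of T] by simp

lemma bop_apply_scaleR: "bop_apply T (r *\<^sub>R x) = r *\<^sub>R bop_apply T x"
  by (simp add: bop_apply_scaleC scaleC_of_real[symmetric])

lemma bop_apply_zero: "bop_apply T 0 = 0"
  using bop_apply_scaleR[of T 0 0] by simp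

lemma bop_eqI: "(\<And>x. bop_apply S x = bop_apply T x) \<Longrightarrow> S = T"
  by (simp add: bop_apply_inject[symmetric] fun_eq_iff)

text \<open>Multiplication is composition.  The class \<open>ring_1\<close> is not instantiated because the
  identity equals \<open>0\<close> on the zero space.\<close>

instantiation bop :: (complex_hilbert_space) "{ring, monoid_mult, complex_vector}"
begin
lift_definition zero_bop :: "'a bop" is "\<lambda>_. 0" by simp
lift_definition one_bop :: "'a bop" is "\<lambda>x. x" by (simp add: bounded_linear_ident)
lift_definition plus_bop :: "'a bop \<Rightarrow> 'a bop \<Rightarrow> 'a bop" is "\<lambda>S T x. S x + T x"
  by (simp add: bounded_linear_add scaleC_add_right)
lift_definition uminus_bop :: "'a bop \<Rightarrow> 'a bop" is "\<lambda>T x. - T x"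
  by (simp add: bounded_linear_minus scaleC_minus_right)
lift_definition minus_bop :: "'a bop \<Rightarrow> 'a bop \<Rightarrow> 'a bop" is "\<lambda>S T x. S x - T x"
  by (simp add: bounded_linear_sub scaleC_diff_right)
lift_definition times_bop :: "'a bop \<Rightarrow> 'a bop \<Rightarrow> 'a bop" is "\<lambda>S T x. S (T x)"
  by (simp add: bounded_linear_compose)
lift_definition scaleR_bop :: "real \<Rightarrow> 'a bop \<Rightarrow> 'a bop" is "\<lambda>r T x. r *\<^sub>R T x"
  by (simp add: bounded_linear_const_scaleR scaleC_scaleR_commute)
lift_definition scaleC_bop :: "complex \<Rightarrow> 'a bop \<Rightarrow> 'a bop" is "\<lambda>c T x. c *\<^sub>C T x"
  by (simp add: bounded_linear_compose[OF bounded_linear_scaleC] scaleC_scaleC mult.commute)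

lemmas bop_apply_simps =
  zero_bop.rep_eq one_bop.rep_eq plus_bop.rep_eq uminus_bop.rep_eq minus_bop.rep_eq
  times_bop.rep_eq scaleR_bop.rep_eq scaleC_bop.rep_eq

instance
  by standard
    (rule bop_eqI, simp add: bop_apply_simps bop_apply_add bop_apply_scaleC bop_apply_scaleR
      scaleR_add_right scaleR_add_left scaleC_add_right scaleC_add_left scaleC_scaleC
      scaleC_of_real)+
end

text \<open>\<open>T \<ge> 0\<close> means that \<open>cinner (T x) x\<close> is real and nonnegative for all \<open>x\<close>.\<close>

instantiation bop :: (complex_hilbert_space) order
begin
definition less_eq_bop :: "'a bop \<Rightarrow> 'a bop \<Rightarrow> bool" where
  "S \<le> T \<longleftrightarrow> (\<forall>x. cinner (bop_apply (T - S) x) x \<in> \<real>\<^sub>\<ge>\<^sub>0)"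
definition less_bop :: "'a bop \<Rightarrow> 'a bop \<Rightarrow> bool" where
  "(S :: 'a bop) < T \<longleftrightarrow> S \<le> T \<and> \<not> T \<le> S"
instance
proof
  fix R S T :: "'a bop"
  show "S < T \<longleftrightarrow> S \<le> T \<and> \<not> T \<le> S" by (rule less_bop_def)
  show "S \<le> S" by (simp add: less_eq_bop_def zero_bop.rep_eq)
  show "R \<le> T" if "R \<le> S" "S \<le> T"
  proof -
    have "cinner (bop_apply (T - R) x) x =
        cinner (bop_apply (T - S) x) x + cinner (bop_apply (S - R) x) x" for x
      by (simp add: minus_bop.rep_eq cinner_diff_left)
    with that show ?thesis
      unfolding less_eq_bop_def by (simp only: nonneg_Reals_add_I simp_thms)
  qed
  show "S = T" if "S \<le> T" "T \<le> S"
  proof -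
    define D where "D = bop_apply (T - S)"
    have q: "cinner (D x) x = 0" for x
    proof -
      have "cinner (D x) x \<in> \<real>\<^sub>\<ge>\<^sub>0"
        using that(1) by (simp add: less_eq_bop_def D_def)
      moreover have "cinner (bop_apply S x) x - cinner (bop_apply T x) x \<in> \<real>\<^sub>\<ge>\<^sub>0"
        using that(2) by (simp add: less_eq_bop_def minus_bop.rep_eq cinner_diff_left)
      ultimately show ?thesis
        by (auto simp: complex_nonneg_Reals_iff complex_eq_iff D_def minus_bop.rep_eq
            cinner_diff_left)
    qed
    have "D x = 0" for x
    proof -
      have a: "cinner (D x) y + cinner (D y) x = 0" for y
        using q[of "x + y"] q[of x] q[of y]
        by (simp add: D_def bop_apply_add cinner_add_left cinner_add_right add.commute)
      have "cinner (D x) (\<i> *\<^sub>C D x) + cinner (D (\<i> *\<^sub>C D x)) x = 0" by (rule a)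
      then have "\<i> * (cinner (D (D x)) x - cinner (D x) (D x)) = 0"
        by (simp add: D_def bop_apply_scaleC cinner_scaleC_left cinner_scaleC_right
            right_diff_distrib)
      with a[of "D x"] have "cinner (D x) (D x) = 0" by simp
      then show ?thesis by (simp add: cinner_self)
    qed
    then have "bop_apply S x = bop_apply T x" for x
      by (simp add: D_def minus_bop.rep_eq)
    then show ?thesis by (rule bop_eqI)
  qed
qed
end

definition adj :: "'h::complex_hilbert_space bop \<Rightarrow> 'h bop" where
  "adj T = (THE S. \<forall>x y. cinner (bop_apply T x) y = cinner x (bop_apply S y))"

definition invertible_bop :: "'h::complex_hilbert_space bop \<Rightarrow> bool" where
  "invertible_bop T \<longleftrightarrow> (\<exists>S. S * T = 1 \<and> T * S = 1)"

text \<open>The weak operator topology: the initial topology for the maps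
  \<open>T \<mapsto> cinner (T x) y\<close> (the function type carries the product topology).\<close>

definition wot :: "'h::complex_hilbert_space bop topology" where
  "wot = pullback_topology UNIV (\<lambda>T (x, y). cinner (bop_apply T x) y) euclidean"

definition von_neumann_algebra :: "'h::complex_hilbert_space bop set \<Rightarrow> bool" where
  "von_neumann_algebra M \<longleftrightarrow>
     1 \<in> M \<and> (\<forall>S\<in>M. \<forall>T\<in>M. S + T \<in> M \<and> S * T \<in> M) \<and>
     (\<forall>c. \<forall>T\<in>M. c *\<^sub>C T \<in> M) \<and> (\<forall>T\<in>M. adj T \<in> M) \<and> closedin wot M"

definition generated_von_neumann_algebra ::
    "'h::complex_hilbert_space bop set \<Rightarrow> 'h bop set" where
  "generated_von_neumann_algebra G = \<Inter> {M. von_neumann_algebra M \<and> G \<subseteq> M}"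


section \<open>Words, free holomorphic functions and the maps \<open>\<Phi>\<close>\<close>

text \<open>The free monoid on \<open>n\<close> generators consists of the lists over \<open>{1..n}\<close>.  A formal power
  series in \<open>n\<close> noncommuting variables is its family of coefficients \<open>a :: nat list \<Rightarrow> real\<close>,
  of which only the values on \<open>words n\<close> matter.  Likewise a tuple \<open>X i j\<close> of operators matters
  only for \<open>i \<in> {1..k}\<close> and \<open>j \<in> {1..n i}\<close>.\<close>

definition words :: "nat \<Rightarrow> nat list set" where
  "words n = lists {1..n}"

definition word_op :: "(nat \<Rightarrow> 'h::complex_hilbert_space bop) \<Rightarrow> nat list \<Rightarrow> 'h bop" where
  "word_op X \<alpha> = prod_list (map X \<alpha>)"

definition positive_regular :: "nat \<Rightarrow> (nat list \<Rightarrow> real) \<Rightarrow> bool" where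
  "positive_regular n a \<longleftrightarrow>
     (\<forall>\<alpha>\<in>words n. 0 \<le> a \<alpha>) \<and> a [] = 0 \<and> (\<forall>j\<in>{1..n}. 0 < a [j]) \<and>
     limsup (\<lambda>p. ereal ((\<Sum>\<alpha> | \<alpha> \<in> words n \<and> length \<alpha> = p. \<bar>a \<alpha>\<bar>\<^sup>2) powr (1 / (2 * real p)))) < \<infinity>"

text \<open>\<open>has_wot_sum f I S\<close>: the net of finite partial sums converges to \<open>S\<close> in the weak operator
  topology.\<close>

definition has_wot_sum ::
    "('i \<Rightarrow> 'h::complex_hilbert_space bop) \<Rightarrow> 'i set \<Rightarrow> 'h bop \<Rightarrow> bool" where
  "has_wot_sum f I S \<longleftrightarrow> limitin wot (\<lambda>F. \<Sum>\<alpha>\<in>F. f \<alpha>) S (finite_subsets_at_top I)"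

definition Phi_well_defined ::
    "nat \<Rightarrow> (nat list \<Rightarrow> real) \<Rightarrow> (nat \<Rightarrow> 'h::complex_hilbert_space bop) \<Rightarrow> bool" where
  "Phi_well_defined n a X \<longleftrightarrow>
     (\<exists>S. has_wot_sum (\<lambda>\<alpha>. a \<alpha> *\<^sub>R (word_op X \<alpha> * adj (word_op X \<alpha>))) (words n) S)"

definition Phi :: "nat \<Rightarrow> (nat list \<Rightarrow> real) \<Rightarrow> (nat \<Rightarrow> 'h::complex_hilbert_space bop) \<Rightarrow>
    'h bop \<Rightarrow> 'h bop" where
  "Phi n a X Y =
     (THE S. has_wot_sum (\<lambda>\<alpha>. a \<alpha> *\<^sub>R (word_op X \<alpha> * Y * adj (word_op X \<alpha>))) (words n) S)"


section \<open>Polydomains and varieties\<close>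

definition cross_commuting ::
    "nat \<Rightarrow> (nat \<Rightarrow> nat) \<Rightarrow> (nat \<Rightarrow> nat \<Rightarrow> 'h::complex_hilbert_space bop) \<Rightarrow> bool" where
  "cross_commuting k n X \<longleftrightarrow>
     (\<forall>s\<in>{1..k}. \<forall>t\<in>{1..k}. s \<noteq> t \<longrightarrow>
        (\<forall>j\<in>{1..n s}. \<forall>l\<in>{1..n t}. X s j * X t l = X t l * X s j))"

text \<open>\<open>compose_upto k F\<close> is \<open>F 1 \<circ> \<dots> \<circ> F k\<close>, \<open>compose_downto k F\<close> is \<open>F k \<circ> \<dots> \<circ> F 1\<close>.\<close>

definition compose_upto :: "nat \<Rightarrow> (nat \<Rightarrow> 'b \<Rightarrow> 'b) \<Rightarrow> 'b \<Rightarrow> 'b" where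
  "compose_upto k F = foldr (\<circ>) (map F [1..<Suc k]) id"

definition compose_downto :: "nat \<Rightarrow> (nat \<Rightarrow> 'b \<Rightarrow> 'b) \<Rightarrow> 'b \<Rightarrow> 'b" where
  "compose_downto k F = foldr (\<circ>) (map F (rev [1..<Suc k])) id"

definition Delta :: "nat \<Rightarrow> (nat \<Rightarrow> nat) \<Rightarrow> (nat \<Rightarrow> nat list \<Rightarrow> real) \<Rightarrow>
    (nat \<Rightarrow> nat \<Rightarrow> 'h::complex_hilbert_space bop) \<Rightarrow> (nat \<Rightarrow> nat) \<Rightarrow> 'h bop \<Rightarrow> 'h bop" where
  "Delta k n a X p = compose_upto k (\<lambda>i. (\<lambda>Y. Y - Phi (n i) (a i) (X i) Y) ^^ p i)"

definition polydomain :: "nat \<Rightarrow> (nat \<Rightarrow> nat) \<Rightarrow> (nat \<Rightarrow> nat) \<Rightarrow> (nat \<Rightarrow> nat list \<Rightarrow> real) \<Rightarrow>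
    (nat \<Rightarrow> nat \<Rightarrow> 'h::complex_hilbert_space bop) set" where
  "polydomain k n m a =
     {X. cross_commuting k n X \<and>
         (\<forall>i\<in>{1..k}. Phi_well_defined (n i) (a i) (X i)) \<and>
         (\<forall>p. (\<forall>i\<in>{1..k}. p i \<le> m i) \<longrightarrow> 0 \<le> Delta k n a X p 1)}"

text \<open>Since variables from different groups commute, the monomials in the \<open>Z i j\<close> are the
  elements \<open>w\<close> of the product of the \<open>k\<close> free monoids, and a polynomial is a finitely supported
  family of complex coefficients indexed by them.\<close>

definition monomials :: "nat \<Rightarrow> (nat \<Rightarrow> nat) \<Rightarrow> (nat \<Rightarrow> nat list) set" where
  "monomials k n = {w. (\<forall>i\<in>{1..k}. w i \<in> words (n i)) \<and> (\<forall>i. i \<notin> {1..k} \<longrightarrow> w i = [])}"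

definition polynomials :: "nat \<Rightarrow> (nat \<Rightarrow> nat) \<Rightarrow> ((nat \<Rightarrow> nat list) \<Rightarrow>\<^sub>0 complex) set" where
  "polynomials k n = {q. Poly_Mapping.keys q \<subseteq> monomials k n}"

definition poly_eval :: "nat \<Rightarrow> ((nat \<Rightarrow> nat list) \<Rightarrow>\<^sub>0 complex) \<Rightarrow>
    (nat \<Rightarrow> nat \<Rightarrow> 'h::complex_hilbert_space bop) \<Rightarrow> 'h bop" where
  "poly_eval k q X =
     (\<Sum>w\<in>Poly_Mapping.keys q.
        Poly_Mapping.lookup q w *\<^sub>C prod_list (map (\<lambda>i. word_op (X i) (w i)) [1..<Suc k]))"

definition variety :: "nat \<Rightarrow> (nat \<Rightarrow> nat) \<Rightarrow> (nat \<Rightarrow> nat) \<Rightarrow> (nat \<Rightarrow> nat list \<Rightarrow> real) \<Rightarrow>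
    ((nat \<Rightarrow> nat list) \<Rightarrow>\<^sub>0 complex) set \<Rightarrow>
    (nat \<Rightarrow> nat \<Rightarrow> 'h::complex_hilbert_space bop) set" where
  "variety k n m a \<Q> = {X \<in> polydomain k n m a. \<forall>q\<in>\<Q>. poly_eval k q X = 0}"


section \<open>The boundedness conditions\<close>

definition power_bounded_between :: "nat \<Rightarrow> (nat \<Rightarrow> nat) \<Rightarrow> (nat \<Rightarrow> nat list \<Rightarrow> real) \<Rightarrow>
    (nat \<Rightarrow> nat \<Rightarrow> 'h::complex_hilbert_space bop) \<Rightarrow> real \<Rightarrow> real \<Rightarrow> bool" where
  "power_bounded_between k n a A c d \<longleftrightarrow>
     (\<forall>s :: nat \<Rightarrow> nat.
        c *\<^sub>R 1 \<le> compose_upto k (\<lambda>i. Phi (n i) (a i) (A i) ^^ s i) 1 \<and>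
        compose_upto k (\<lambda>i. Phi (n i) (a i) (A i) ^^ s i) 1 \<le> d *\<^sub>R 1)"

text \<open>The iterated sum over \<open>0 \<le> s i < p i\<close> is written as one sum over the multi-indices \<open>s\<close> in
  the box \<open>{..<p 1} \<times> \<dots> \<times> {..<p k}\<close>.\<close>

definition cesaro_mean :: "nat \<Rightarrow> (nat \<Rightarrow> nat) \<Rightarrow> (nat \<Rightarrow> nat list \<Rightarrow> real) \<Rightarrow>
    (nat \<Rightarrow> nat \<Rightarrow> 'h::complex_hilbert_space bop) \<Rightarrow> (nat \<Rightarrow> nat) \<Rightarrow> 'h bop" where
  "cesaro_mean k n a A p =
     (1 / real (\<Prod>i\<in>{1..k}. p i)) *\<^sub>R
     (\<Sum>s\<in>PiE {1..k} (\<lambda>i. {..<p i}).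
        compose_downto k (\<lambda>i. Phi (n i) (a i) (A i) ^^ s i) 1)"

definition means_bounded_between :: "nat \<Rightarrow> (nat \<Rightarrow> nat) \<Rightarrow> (nat \<Rightarrow> nat list \<Rightarrow> real) \<Rightarrow>
    (nat \<Rightarrow> nat \<Rightarrow> 'h::complex_hilbert_space bop) \<Rightarrow> real \<Rightarrow> real \<Rightarrow> bool" where
  "means_bounded_between k n a A c d \<longleftrightarrow>
     (\<forall>p :: nat \<Rightarrow> nat. (\<forall>i\<in>{1..k}. 1 \<le> p i) \<longrightarrow>
        c *\<^sub>R 1 \<le> cesaro_mean k n a A p \<and> cesaro_mean k n a A p \<le> d *\<^sub>R 1)"

end

theory Submission
  imports Defs
begin

text \<open>Conditions (ii)-(iv) are linked through the Cesaro means \<open>M\<close> over the cubes with side \<open>N\<close>.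
  The maps \<open>\<Phi>\<close> are positive and commute on the positive cone, so telescoping leaves only the
  boundary terms in \<open>\<Phi> M - M\<close>; since two-sided bounds on the means already bound the powers of
  each \<open>\<Phi>\<close>, these terms are \<open>O(1/N)\<close>.  Any weak cluster point \<open>Q\<close> of the means inherits their
  bounds and lies in the von Neumann algebra.  A Fatou argument gives \<open>\<Phi> Q \<le> Q\<close> and, applied to
  \<open>d - M\<close>, the reverse inequality, which avoids any continuity property of \<open>\<Phi>\<close>.
  A factorization \<open>Q = R R*\<close> turns a fixed point \<open>Q\<close> into the similarity \<open>T = R\<inverse> A R\<close> of (i), and
  conversely.\<close>

section \<open>Operators on a complex Hilbert space\<close>

text \<open>The implications run (iv) => (ii) => (iii) => (iv), with (i) <=> (iv) apart. Passing
  from (ii) to (iii) keeps \<open>c\<close> and \<open>d\<close>, and order bounds survive weak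
  limits, so one construction of \<open>Q\<close> settles the final claim for either pair of
  constants. Telescoping along one axis leaves a face of the cube and its image under the
  \<open>N\<close>-th power of the map. A face has \<open>N ^ (k - 1)\<close> points against
  \<open>N ^ k\<close> in the cube, which is the origin of O(1/N). The Fatou step rests on finite
  partial sums of \<open>\<Phi>\<close>: they are weakly continuous and, at positive arguments, lie
  below the full value. This controls \<open>\<Phi>\<close> of a limit only from above, so the lower
  estimate for \<open>\<Phi> Q\<close> has to come from positive operators that decrease as
  \<open>M\<close> increases. The series for \<open>\<Phi>\<close> involves adjoints, yet operators
  of different groups need not commute with each other's adjoints. All commutation is therefore
  obtained from conjugations \<open>Y \<mapsto> C * Y * adj C\<close>. Once \<open>\<Phi>\<close>
  for \<open>T\<close> fixes 1, every defect operator of \<open>T\<close> at 1 is 0 or 1, so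
  \<open>T\<close> lies in the polydomain for every \<open>m\<close> without further
  estimates.\<close>

lemma cinner_zero_right [simp]: "cinner x (0 :: 'h::complex_hilbert_space) = 0"
  by (subst cinner_commute) simp

lemma cinner_diff_right:
  "cinner x (y - z) = cinner x y - cinner x (z :: 'h::complex_hilbert_space)"
  by (metis add_diff_cancel_right' cinner_add_right diff_add_cancel)

lemma cinner_scaleR_left: "cinner (r *\<^sub>R x) y = r * cinner x (y :: 'h::complex_hilbert_space)"
  by (metis cinner_scaleC_left scaleC_of_real)

lemma cinner_scaleR_right: "cinner x (r *\<^sub>R y) = r * cinner x (y :: 'h::complex_hilbert_space)"
  by (metis cinner_scaleC_right scaleC_of_real complex_cnj_complex_of_real)

lemma cinner_sum_left:
  "cinner (\<Sum>i\<in>I. f i) y = (\<Sum>i\<in>I. cinner (f i) (y :: 'h::complex_hilbert_space))"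
  by (induction I rule: infinite_finite_induct) (auto simp: cinner_add_left)

lemma Re_cinner_commute: "Re (cinner x y) = Re (cinner y (x :: 'h::complex_hilbert_space))"
  by (subst cinner_commute) simp

lemma Re_cinner_self: "Re (cinner x x) = (norm (x :: 'h::complex_hilbert_space))\<^sup>2"
  by (simp add: cinner_self)

lemma norm_add_power2:
  "(norm (x + y))\<^sup>2 = (norm x)\<^sup>2 + 2 * Re (cinner x y) + (norm (y :: 'h::complex_hilbert_space))\<^sup>2"
  using Re_cinner_commute[of x y]
  by (simp add: Re_cinner_self[symmetric] cinner_add_left cinner_add_right)

lemma norm_diff_power2:
  "(norm (x - y))\<^sup>2 = (norm x)\<^sup>2 - 2 * Re (cinner x y) + (norm (y :: 'h::complex_hilbert_space))\<^sup>2"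
  using Re_cinner_commute[of x y]
  by (simp add: Re_cinner_self[symmetric] cinner_diff_left cinner_diff_right)

text \<open>Expand the squared distance from \<open>x\<close> to its projection
  \<open>(c / t) *\<^sub>C y\<close> onto the line through \<open>y\<close>.\<close>

lemma Cauchy_Schwarz_cinner: "cmod (cinner x y) \<le> norm x * norm (y :: 'h::complex_hilbert_space)"
proof (cases "y = 0")
  case False
  define c where "c = cinner x y"
  define t where "t = (norm y)\<^sup>2"
  have t: "t > 0" using False by (simp add: t_def)
  have nt: "(norm ((c / t) *\<^sub>C y))\<^sup>2 = (cmod c / t)\<^sup>2 * t"
    unfolding norm_scaleC power_mult_distrib t_def[symmetric] using t by (simp add: norm_divide)
  have "0 \<le> (norm (x - (c / t) *\<^sub>C y))\<^sup>2" by simp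
  also have "\<dots> = (norm x)\<^sup>2 - 2 * Re (cnj (c / t) * c) + (cmod c / t)\<^sup>2 * t"
    by (simp only: norm_diff_power2 nt cinner_scaleC_right c_def[symmetric])
  also have "cnj (c / t) * c = complex_of_real ((cmod c)\<^sup>2 / t)"
    by (simp only: complex_norm_square of_real_divide complex_cnj_divide complex_cnj_complex_of_real)
      (simp add: mult.commute)
  also have "(norm x)\<^sup>2 - 2 * Re (complex_of_real ((cmod c)\<^sup>2 / t)) + (cmod c / t)\<^sup>2 * t =
      (norm x)\<^sup>2 - (cmod c)\<^sup>2 / t"
    using t by (simp add: power2_eq_square field_simps)
  finally have "(cmod c)\<^sup>2 \<le> (norm x * norm y)\<^sup>2"
    using t by (simp add: field_simps t_def power_mult_distrib)
  then show ?thesis unfolding c_def by (rule power2_le_imp_le) simp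
qed simp

text \<open>The representing vector is the minimiser of \<open>(norm x)\<^sup>2 - 2 * Re (f x)\<close>; the parallelogram
  law makes a minimising sequence Cauchy.\<close>

lemma Riesz_representation:
  fixes f :: "'h::complex_hilbert_space \<Rightarrow> complex"
  assumes add: "\<And>x y. f (x + y) = f x + f y"
    and scale: "\<And>c x. f (c *\<^sub>C x) = c * f x"
    and bound: "\<And>x. cmod (f x) \<le> C * norm x"
  shows "\<exists>z. \<forall>x. f x = cinner x z"
proof -
  define J where "J x = (norm x)\<^sup>2 - 2 * Re (f x)" for x
  have scaleR: "f (r *\<^sub>R x) = r * f x" for r x
    by (metis scale scaleC_of_real)
  have low: "- (C\<^sup>2) \<le> J x" for x
  proof -
    have "Re (f x) \<le> C * norm x" using bound[of x] complex_Re_le_cmod order_trans by blast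
    moreover have "0 \<le> (norm x - C)\<^sup>2" by simp
    ultimately show ?thesis by (simp add: J_def power2_eq_square algebra_simps)
  qed
  then have bdd: "bdd_below (range J)" by (meson bdd_belowI2)
  define m where "m = Inf (range J)"
  have m_le: "m \<le> J x" for x unfolding m_def by (rule cInf_lower[OF _ bdd]) simp
  have "\<exists>x. J x < m + e" if "e > 0" for e
    using cInf_lessD[of "range J" "m + e"] that by (auto simp: m_def)
  then have "\<forall>n. \<exists>x. J x < m + inverse (real (Suc n))" by simp
  then obtain X where X: "J (X n) < m + inverse (real (Suc n))" for n by metis
  have par: "(norm (x - y))\<^sup>2 \<le> 2 * (J x - m) + 2 * (J y - m)" for x y
  proof -
    have "J ((1/2) *\<^sub>R (x + y)) = (norm (x + y))\<^sup>2 / 4 - (Re (f x) + Re (f y))"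
      by (simp add: J_def scaleR add power_divide) (simp add: field_simps)
    also have "\<dots> = ((norm x)\<^sup>2 + 2 * Re (cinner x y) + (norm y)\<^sup>2) / 4 - (Re (f x) + Re (f y))"
      by (simp only: norm_add_power2)
    finally have "m \<le> ((norm x)\<^sup>2 + 2 * Re (cinner x y) + (norm y)\<^sup>2) / 4 - (Re (f x) + Re (f y))"
      using m_le[of "(1/2) *\<^sub>R (x + y)"] by simp
    then show ?thesis unfolding norm_diff_power2 J_def by argo
  qed
  have "Cauchy X"
  proof (rule metric_CauchyI)
    fix e :: real assume "0 < e"
    then have "e\<^sup>2 / 4 > 0" by simp
    then obtain N where N: "inverse (real (Suc N)) < e\<^sup>2 / 4" using reals_Archimedean by blast
    have less: "J (X n) - m < e\<^sup>2 / 4" if "n \<ge> N" for n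
    proof -
      have "inverse (real (Suc n)) \<le> inverse (real (Suc N))" using that by simp
      with X[of n] N show ?thesis by linarith
    qed
    have "dist (X i) (X j) < e" if "i \<ge> N" "j \<ge> N" for i j
    proof -
      have "(dist (X i) (X j))\<^sup>2 < e\<^sup>2"
        using par[of "X i" "X j"] less[OF that(1)] less[OF that(2)] by (simp add: dist_norm)
      then show ?thesis using \<open>0 < e\<close> by (simp add: power_less_imp_less_base)
    qed
    then show "\<exists>N. \<forall>i\<ge>N. \<forall>j\<ge>N. dist (X i) (X j) < e" by blast
  qed
  then obtain z where z: "X \<longlonglongrightarrow> z" using Cauchy_convergent convergentD by blast
  have "bounded_linear f"
    by (rule bounded_linear_intro[where K = C]) (use add scaleR bound in \<open>auto simp: scaleR_conv_of_real mult.commute\<close>)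
  then have "(\<lambda>n. f (X n)) \<longlonglongrightarrow> f z" by (rule bounded_linear.tendsto) (rule z)
  then have "(\<lambda>n. J (X n)) \<longlonglongrightarrow> J z" unfolding J_def by (intro tendsto_intros z)
  moreover have "(\<lambda>n. m + inverse (real (Suc n))) \<longlonglongrightarrow> m + 0"
    by (intro tendsto_intros LIMSEQ_inverse_real_of_nat)
  ultimately have "J z \<le> m + 0"
    by (rule LIMSEQ_le) (use X less_imp_le in blast)
  then have min: "J z \<le> J x" for x using m_le[of x] by simp
  have re: "Re (f v) = Re (cinner v z)" for v
  proof -
    define b where "b = 2 * (Re (cinner z v) - Re (f v))"
    have q: "0 \<le> t * b + t\<^sup>2 * (norm v)\<^sup>2" for t
      using min[of "z + t *\<^sub>R v"]
      by (simp add: J_def norm_add_power2 add scaleR cinner_scaleR_right b_def algebra_simps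
          power_mult_distrib)
    \<comment> \<open>The variation \<open>t = - b / s\<close> makes the quadratic \<open>q\<close>
      equal to a negative square. Adding 1 keeps \<open>s\<close> positive when
      \<open>v = 0\<close>.\<close>
    define s where "s = (norm v)\<^sup>2 + 1"
    have s: "s > 0" "(norm v)\<^sup>2 = s - 1" by (simp_all add: s_def add_nonneg_pos)
    have "0 \<le> (- b / s) * b + (- b / s)\<^sup>2 * (s - 1)" using q[of "- b / s"] s by simp
    also have "\<dots> = - (b / s)\<^sup>2" using s by (simp add: field_simps power2_eq_square)
    finally have "b = 0" using s by simp
    then show ?thesis using Re_cinner_commute[of z v] by (simp add: b_def)
  qed
  have "f v = cinner v z" for v
  proof (rule complex_eqI)
    show "Re (f v) = Re (cinner v z)" by (rule re)
    show "Im (f v) = Im (cinner v z)"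
      using re[of "\<i> *\<^sub>C v"] by (simp add: scale cinner_scaleC_left)
  qed
  then show ?thesis by blast
qed

section \<open>Bounded sesquilinear forms and adjoints\<close>

lemma bop_apply_diff: "bop_apply T (x - y) = bop_apply T x - bop_apply T y"
  by (metis add_diff_cancel_right' bop_apply_add diff_add_cancel)

lemma bop_bounded: "\<exists>K>0. \<forall>x. norm (bop_apply T x) \<le> K * norm x"
proof -
  have "bounded_linear (bop_apply T)" using bop_apply[of T] by simp
  from bounded_linear.pos_bounded[OF this] show ?thesis by (simp add: mult.commute)
qed

lemma cinner_ext:
  assumes "\<And>y. cinner u y = cinner v y"
  shows "u = (v :: 'h::complex_hilbert_space)"
proof -
  have "cinner (u - v) (u - v) = 0"
    by (simp add: cinner_diff_left assms)
  then show ?thesis by (simp add: cinner_self)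
qed

lemma bop_eqI_cinner:
  assumes "\<And>x y. cinner (bop_apply S x) y = cinner (bop_apply T x) y"
  shows "S = T"
  by (rule bop_eqI, rule cinner_ext, rule assms)

text \<open>Riesz applied to \<open>y \<mapsto> cnj (B x y)\<close>, which is linear in
  \<open>y\<close>. A bound on unit balls is assumed because that is what adjoints and weak limits
  provide.\<close>

lemma bounded_form_representation:
  fixes B :: "'h::complex_hilbert_space \<Rightarrow> 'h \<Rightarrow> complex"
  assumes add1: "\<And>x x' y. B (x + x') y = B x y + B x' y"
    and add2: "\<And>x y y'. B x (y + y') = B x y + B x y'"
    and scale1: "\<And>c x y. B (c *\<^sub>C x) y = c * B x y"
    and scale2: "\<And>c x y. B x (c *\<^sub>C y) = cnj c * B x y"
    and bound: "\<And>x y. norm x \<le> 1 \<Longrightarrow> norm y \<le> 1 \<Longrightarrow> cmod (B x y) \<le> C"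
  shows "\<exists>T. \<forall>x y. B x y = cinner (bop_apply T x) y"
proof -
  have bd: "cmod (B x y) \<le> C * norm x * norm y" for x y
  proof -
    \<comment> \<open>Since \<open>inverse 0 = 0\<close>, normalizing the zero vector gives zero,
      and both facts cover this case too.\<close>
    have unit: "norm (inverse (norm x) *\<^sub>R x) \<le> 1" for x :: 'h by (cases "x = 0") simp_all
    have dec: "x = complex_of_real (norm x) *\<^sub>C (inverse (norm x) *\<^sub>R x)" for x :: 'h
      by (cases "x = 0") (simp_all add: scaleC_of_real)
    have "cmod (B x y) = norm x * norm y * cmod (B (inverse (norm x) *\<^sub>R x) (inverse (norm y) *\<^sub>R y))"
    proof -
      have "cmod (B x y) = cmod (B (complex_of_real (norm x) *\<^sub>C (inverse (norm x) *\<^sub>R x))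
          (complex_of_real (norm y) *\<^sub>C (inverse (norm y) *\<^sub>R y)))"
        by (simp only: dec[symmetric])
      also have "\<dots> = norm x * norm y * cmod (B (inverse (norm x) *\<^sub>R x) (inverse (norm y) *\<^sub>R y))"
        unfolding scale1 scale2 norm_mult complex_mod_cnj norm_of_real abs_norm_cancel
        by (simp only: mult_ac)
      finally show ?thesis .
    qed
    also have "\<dots> \<le> norm x * norm y * C"
      by (intro mult_left_mono bound unit) simp
    finally show ?thesis by (simp add: mult_ac)
  qed
  have C: "0 \<le> C" using order_trans[OF norm_ge_zero bound[of 0 0]] by simp
  have "\<exists>z. \<forall>y. cnj (B x y) = cinner y z" for x
    by (rule Riesz_representation[where C = "C * norm x"])
      (use bd in \<open>auto simp: add2 scale2\<close>)
  then obtain T where T': "\<And>x y. cnj (B x y) = cinner y (T x)" by metis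
  have T: "B x y = cinner (T x) y" for x y
    using arg_cong[OF T'[of x y], of cnj] by (simp add: cinner_commute[symmetric])
  have add: "T (x + y) = T x + T y" for x y
    by (rule cinner_ext) (simp add: T[symmetric] cinner_add_left add1)
  have scale: "T (c *\<^sub>C x) = c *\<^sub>C T x" for c x
    by (rule cinner_ext) (simp add: T[symmetric] cinner_scaleC_left scale1)
  have nb: "norm (T x) \<le> C * norm x" for x
  proof (cases "T x = 0")
    case False
    have "norm (T x) * norm (T x) \<le> (C * norm x) * norm (T x)"
      using bd[of x "T x"] by (simp add: T cinner_self norm_mult power2_eq_square)
    then show ?thesis using False by simp
  qed (simp add: C)
  have "bounded_linear T"
    by (rule bounded_linear_intro[where K = C])
      (simp_all only: add nb scale scaleC_of_real[symmetric] mult.commute[of _ C])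
  with scale have "bop_apply (Abs_bop T) = T" by (simp add: Abs_bop_inverse)
  with T have "\<forall>x y. B x y = cinner (bop_apply (Abs_bop T) x) y" by simp
  then show ?thesis ..
qed

text \<open>\<open>adj\<close> is a definite description, so its properties depend on existence. The
  operator represents the form \<open>cinner y (T x)\<close>, linear in \<open>y\<close> and
  conjugate linear in \<open>x\<close>.\<close>

lemma adj_exists: "\<exists>S. \<forall>x y. cinner (bop_apply T x) y = cinner x (bop_apply S y)"
proof -
  obtain K where K: "0 < K" "\<And>x. norm (bop_apply T x) \<le> K * norm x" using bop_bounded[of T] by auto
  have "\<exists>S. \<forall>y x. cinner y (bop_apply T x) = cinner (bop_apply S y) x"
  proof (rule bounded_form_representation)
    fix y x :: 'a assume "norm y \<le> 1" "norm x \<le> 1"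
    have "cmod (cinner y (bop_apply T x)) \<le> norm y * norm (bop_apply T x)"
      by (rule Cauchy_Schwarz_cinner)
    also have "\<dots> \<le> 1 * (K * 1)"
    proof (rule mult_mono)
      show "norm (bop_apply T x) \<le> K * 1"
        using K(2)[of x] mult_left_mono[OF \<open>norm x \<le> 1\<close>, of K] K(1) by linarith
    qed (use \<open>norm y \<le> 1\<close> in simp_all)
    finally show "cmod (cinner y (bop_apply T x)) \<le> K" by simp
  qed (simp_all add: cinner_add_left cinner_add_right cinner_scaleC_left cinner_scaleC_right
      bop_apply_add bop_apply_scaleC)
  then obtain S where S: "cinner y (bop_apply T x) = cinner (bop_apply S y) x" for x y by blast
  have "cinner (bop_apply T x) y = cinner x (bop_apply S y)" for x y
    using arg_cong[OF S[of y x], of cnj] by (simp only: cinner_commute[symmetric])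
  then show ?thesis by blast
qed

lemma adj_unique:
  assumes "\<And>x y. cinner (bop_apply T x) y = cinner x (bop_apply S y)"
  shows "adj T = S"
  unfolding adj_def
proof (rule the_equality)
  fix S' assume "\<forall>x y. cinner (bop_apply T x) y = cinner x (bop_apply S' y)"
  with assms have "cinner x (bop_apply S' y) = cinner x (bop_apply S y)" for x y by metis
  then have "cnj (cinner x (bop_apply S' y)) = cnj (cinner x (bop_apply S y))" for x y by simp
  then show "S' = S" by (intro bop_eqI_cinner) (simp only: cinner_commute[symmetric])
qed (use assms in blast)

lemma cinner_adj_right: "cinner (bop_apply T x) y = cinner x (bop_apply (adj T) y)"
  using adj_exists[of T] adj_unique by metis

lemma cinner_adj_left: "cinner (bop_apply (adj T) x) y = cinner x (bop_apply T y)"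
  using arg_cong[OF cinner_adj_right[of T y x], of cnj] by (simp only: cinner_commute[symmetric])

lemma adj_one [simp]: "adj 1 = 1"
  by (rule adj_unique) (simp add: bop_apply_simps)

lemma adj_mult: "adj (S * T) = adj T * adj S"
  by (rule adj_unique) (simp add: bop_apply_simps cinner_adj_right)

section \<open>The operator order and norm bounds\<close>

text \<open>Neither side of the order has to be self-adjoint; only the difference has a real
  quadratic form. Hence the equation between imaginary parts.\<close>

lemma less_eq_bop_iff:
  "S \<le> T \<longleftrightarrow> (\<forall>x. Im (cinner (bop_apply S x) x) = Im (cinner (bop_apply T x) x) \<and>
     Re (cinner (bop_apply S x) x) \<le> Re (cinner (bop_apply T x) x))"
  by (auto simp: less_eq_bop_def complex_nonneg_Reals_iff minus_bop.rep_eq cinner_diff_left)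

instance bop :: (complex_hilbert_space) ordered_real_vector
proof
  fix S T U :: "'a bop" and r s :: real
  show "S \<le> T \<Longrightarrow> U + S \<le> U + T"
    by (simp add: less_eq_bop_iff bop_apply_simps cinner_add_left)
  show "S \<le> T \<Longrightarrow> 0 \<le> r \<Longrightarrow> r *\<^sub>R S \<le> r *\<^sub>R T"
    by (simp add: less_eq_bop_iff bop_apply_simps cinner_scaleR_left mult_left_mono)
  show "r \<le> s \<Longrightarrow> 0 \<le> T \<Longrightarrow> r *\<^sub>R T \<le> s *\<^sub>R T"
    by (simp add: less_eq_bop_iff bop_apply_simps cinner_scaleR_left mult_right_mono)
qed

instance bop :: (complex_hilbert_space) real_algebra
  by standard (rule bop_eqI, simp add: bop_apply_simps bop_apply_scaleR)+

lemma zero_le_one_bop: "0 \<le> (1 :: 'h::complex_hilbert_space bop)"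
  by (simp add: less_eq_bop_iff bop_apply_simps cinner_self del: of_real_power)

lemma conjugate_mono:
  assumes "S \<le> T"
  shows "X * S * adj X \<le> X * T * adj X"
  using assms cinner_adj_right[of X]
  by (simp add: less_eq_bop_iff bop_apply_simps)

text \<open>On a complex space the quadratic form determines the operator. That polarization
  argument is already contained in the antisymmetry of the order.\<close>

lemma adj_positive:
  assumes "0 \<le> T"
  shows "adj T = T"
proof -
  have "cinner (bop_apply (adj T) x) x = cinner (bop_apply T x) x" for x
    using assms cinner_adj_left[of T x x] cinner_commute[of x "bop_apply T x"]
    by (simp add: less_eq_bop_iff bop_apply_simps complex_eq_iff)
  then show ?thesis by (intro antisym) (simp_all add: less_eq_bop_iff)
qed

text \<open>This is \<open>T * T \<le> r *\<^sub>R T\<close>. Testing positivity at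
  \<open>x - (1 / r) *\<^sub>R y\<close> with \<open>y = T x\<close> avoids a square root of
  \<open>T\<close>, whose construction below relies on this estimate.\<close>

lemma positive_norm_power2_le:
  assumes "0 \<le> T" and "T \<le> r *\<^sub>R 1" and "0 < r"
  shows "(norm (bop_apply T x))\<^sup>2 \<le> r * Re (cinner (bop_apply T x) x)"
proof -
  define y where "y = bop_apply T x"
  have sa: "cinner (bop_apply T u) v = cinner u (bop_apply T v)" for u v
    using cinner_adj_right[of T] adj_positive[OF assms(1)] by simp
  have pos: "0 \<le> Re (cinner (bop_apply T u) u)" for u
    using assms(1) by (simp add: less_eq_bop_iff bop_apply_simps)
  have up: "Re (cinner (bop_apply T u) u) \<le> r * (norm u)\<^sup>2" for u
    using assms(2) by (simp add: less_eq_bop_iff bop_apply_simps cinner_scaleR_left Re_cinner_self)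
  have "0 \<le> Re (cinner (bop_apply T (x - (1 / r) *\<^sub>R y)) (x - (1 / r) *\<^sub>R y))" by (rule pos)
  also have "\<dots> = Re (cinner y x) - (2 / r) * (norm y)\<^sup>2 + Re (cinner (bop_apply T y) y) / r\<^sup>2"
    using sa[of y x]
    by (simp add: bop_apply_diff bop_apply_scaleR cinner_diff_left cinner_diff_right
        cinner_scaleR_left cinner_scaleR_right y_def[symmetric] Re_cinner_self power2_eq_square diff_divide_distrib)
  also have "\<dots> \<le> Re (cinner y x) - (2 / r) * (norm y)\<^sup>2 + r * (norm y)\<^sup>2 / r\<^sup>2"
    using up[of y] assms(3) by (simp add: divide_right_mono)
  also have "\<dots> = Re (cinner y x) - (norm y)\<^sup>2 / r"
    using assms(3) by (simp add: field_simps power2_eq_square)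
  finally show ?thesis using assms(3) by (simp add: y_def field_simps)
qed

lemma positive_norm_le:
  assumes "0 \<le> T" and "T \<le> r *\<^sub>R 1" and "0 < r"
  shows "norm (bop_apply T x) \<le> r * norm x"
proof -
  have "Re (cinner (bop_apply T x) x) \<le> r * (norm x)\<^sup>2"
    using assms(2) by (simp add: less_eq_bop_iff bop_apply_simps cinner_scaleR_left Re_cinner_self)
  then have "r * Re (cinner (bop_apply T x) x) \<le> r * (r * (norm x)\<^sup>2)"
    using assms(3) by simp
  with positive_norm_power2_le[OF assms, of x]
  have "(norm (bop_apply T x))\<^sup>2 \<le> (r * norm x)\<^sup>2"
    by (simp add: power_mult_distrib power2_eq_square mult_ac)
  then show ?thesis by (rule power2_le_imp_le) (use assms(3) in simp)
qed

lemma positive_le_scaleR_one: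
  fixes T :: "'h::complex_hilbert_space bop"
  assumes "0 \<le> T"
  shows "\<exists>r>0. T \<le> r *\<^sub>R 1"
proof -
  obtain K where K: "0 < K" "\<And>x. norm (bop_apply T x) \<le> K * norm x"
    using bop_bounded[of T] by auto
  have "Re (cinner (bop_apply T x) x) \<le> K * (norm x)\<^sup>2" for x
  proof -
    have "Re (cinner (bop_apply T x) x) \<le> norm (bop_apply T x) * norm x"
      using complex_Re_le_cmod Cauchy_Schwarz_cinner by (rule order_trans)
    also have "\<dots> \<le> K * norm x * norm x" by (intro mult_right_mono K(2)) simp
    finally show ?thesis by (simp add: power2_eq_square mult.assoc)
  qed
  then have "T \<le> K *\<^sub>R 1"
    using assms
    by (simp add: less_eq_bop_iff bop_apply_simps cinner_scaleR_left Re_cinner_self cinner_self del: of_real_power)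
  with K(1) show ?thesis by blast
qed

text \<open>A bounded inverse gives \<open>norm x \<le> K * norm (Q x)\<close>. The estimate
  \<open>(norm (Q x))\<^sup>2 \<le> r * Re (cinner (Q x) x)\<close> moves this to the quadratic
  form, with constant \<open>1 / (r * K\<^sup>2)\<close>.\<close>

lemma positive_invertible_bounded_below:
  assumes "0 \<le> Q" and "invertible_bop Q"
  shows "\<exists>c>0. c *\<^sub>R 1 \<le> Q"
proof -
  obtain S where S: "S * Q = 1" using assms(2) by (auto simp: invertible_bop_def)
  obtain r where r: "0 < r" "Q \<le> r *\<^sub>R 1" using positive_le_scaleR_one[OF assms(1)] by blast
  obtain K where K: "0 < K" "\<And>x. norm (bop_apply S x) \<le> K * norm x"
    using bop_bounded[of S] by auto
  have "1 / (r * K\<^sup>2) * (norm x)\<^sup>2 \<le> Re (cinner (bop_apply Q x) x)" for x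
  proof -
    have "bop_apply S (bop_apply Q x) = x"
      using arg_cong[OF S, of "\<lambda>T. bop_apply T x"] by (simp add: bop_apply_simps)
    then have "norm x \<le> K * norm (bop_apply Q x)" using K(2)[of "bop_apply Q x"] by simp
    then have "(norm x)\<^sup>2 \<le> (K * norm (bop_apply Q x))\<^sup>2" by (rule power_mono) simp
    also have "\<dots> \<le> K\<^sup>2 * (r * Re (cinner (bop_apply Q x) x))"
      unfolding power_mult_distrib
      by (intro mult_left_mono positive_norm_power2_le assms r) simp
    finally show ?thesis using r(1) K(1) by (simp add: field_simps)
  qed
  then have "(1 / (r * K\<^sup>2)) *\<^sub>R 1 \<le> Q"
    using assms(1) by (auto simp: less_eq_bop_iff bop_apply_simps cinner_scaleR_left Re_cinner_self cinner_self
        simp del: of_real_power)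
  moreover have "1 / (r * K\<^sup>2) > 0" using r(1) K(1) by simp
  ultimately show ?thesis by blast
qed

section \<open>Limits in the weak operator topology\<close>

lemma topspace_wot [simp]: "topspace wot = UNIV"
  by (simp add: wot_def topspace_pullback_topology)

lemma limitin_wot_iff:
  fixes f :: "'i \<Rightarrow> 'h::complex_hilbert_space bop"
  shows "limitin wot f S F \<longleftrightarrow>
     (\<forall>x y. ((\<lambda>i. cinner (bop_apply (f i) x) y) \<longlongrightarrow> cinner (bop_apply S x) y) F)"
proof -
  define g where "g = (\<lambda>(T :: 'h bop) (x, y). cinner (bop_apply T x) y)"
  have "limitin wot f S F \<longleftrightarrow> limitin euclidean (\<lambda>i. g (f i)) (g S) F"
    unfolding limitin_def wot_def g_def[symmetric] openin_pullback_topology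
      topspace_pullback_topology by auto
  also have "\<dots> \<longleftrightarrow> (\<forall>z. ((\<lambda>i. g (f i) z) \<longlongrightarrow> g S z) F)"
    unfolding euclidean_product_topology[symmetric] limitin_componentwise by simp
  finally show ?thesis by (simp add: g_def)
qed

lemma limitin_wot_add:
  assumes "limitin wot f S F" and "limitin wot g T F"
  shows "limitin wot (\<lambda>i. f i + g i) (S + T) F"
  using assms by (simp add: limitin_wot_iff bop_apply_simps cinner_add_left tendsto_add)

lemma limitin_wot_diff:
  assumes "limitin wot f S F" and "limitin wot g T F"
  shows "limitin wot (\<lambda>i. f i - g i) (S - T) F"
  using assms by (simp add: limitin_wot_iff bop_apply_simps cinner_diff_left tendsto_diff)

lemma limitin_wot_scaleR:
  assumes "limitin wot f S F" and "(r \<longlongrightarrow> s) F"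
  shows "limitin wot (\<lambda>i. r i *\<^sub>R f i) (s *\<^sub>R S) F"
  using assms
  by (simp add: limitin_wot_iff bop_apply_simps cinner_scaleR_left tendsto_mult tendsto_of_real)

lemma limitin_wot_mult:
  assumes "limitin wot f S F"
  shows "limitin wot (\<lambda>i. X * f i * Z) (X * S * Z) F"
  using assms by (simp add: limitin_wot_iff bop_apply_simps cinner_adj_right[of X])

lemma limitin_wot_sum:
  assumes "\<And>j. j \<in> J \<Longrightarrow> limitin wot (\<lambda>i. f i j) (S j) F"
  shows "limitin wot (\<lambda>i. \<Sum>j\<in>J. f i j) (\<Sum>j\<in>J. S j) F"
  using assms
  by (induction J rule: infinite_finite_induct) (auto intro: limitin_wot_add)

lemma limitin_wot_unique:
  assumes "F \<noteq> bot" and "limitin wot f S F" and "limitin wot f T F"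
  shows "S = T"
  using assms tendsto_unique unfolding limitin_wot_iff by (intro bop_eqI_cinner) blast

lemma limitin_wot_le:
  assumes "F \<noteq> bot" and "limitin wot f S F" and "limitin wot g T F"
    and "eventually (\<lambda>i. f i \<le> g i) F"
  shows "S \<le> T"
  unfolding less_eq_bop_iff
proof (intro allI conjI)
  fix x
  have f: "((\<lambda>i. cinner (bop_apply (f i) x) x) \<longlongrightarrow> cinner (bop_apply S x) x) F"
    and g: "((\<lambda>i. cinner (bop_apply (g i) x) x) \<longlongrightarrow> cinner (bop_apply T x) x) F"
    using assms(2,3) by (simp_all add: limitin_wot_iff)
  show "Re (cinner (bop_apply S x) x) \<le> Re (cinner (bop_apply T x) x)"
    by (rule tendsto_le[OF assms(1) tendsto_Re[OF g] tendsto_Re[OF f]])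
      (use assms(4) in \<open>auto simp: less_eq_bop_iff elim: eventually_mono\<close>)
  have "eventually (\<lambda>i. Im (cinner (bop_apply (f i) x) x) = Im (cinner (bop_apply (g i) x) x)) F"
    using assms(4) by (rule eventually_mono) (simp add: less_eq_bop_iff)
  then have "((\<lambda>i. Im (cinner (bop_apply (g i) x) x)) \<longlongrightarrow> Im (cinner (bop_apply S x) x)) F"
    using tendsto_Im[OF f] by (simp add: tendsto_cong)
  then show "Im (cinner (bop_apply S x) x) = Im (cinner (bop_apply T x) x)"
    using tendsto_Im[OF g] assms(1) by (metis tendsto_unique)
qed

text \<open>A pointwise limit of sesquilinear forms is sesquilinear, and a bound \<open>C\<close>
  common to all unit vectors makes it the form of an operator. The stage from which the bound holds
  may depend on \<open>x\<close> and \<open>y\<close>.\<close>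

lemma limitin_wot_exists:
  fixes f :: "'i \<Rightarrow> 'h::complex_hilbert_space bop"
  assumes "F \<noteq> bot"
    and lim: "\<And>x y. ((\<lambda>i. cinner (bop_apply (f i) x) y) \<longlongrightarrow> B x y) F"
    and bound: "\<And>x y. norm x \<le> 1 \<Longrightarrow> norm y \<le> 1 \<Longrightarrow>
      eventually (\<lambda>i. cmod (cinner (bop_apply (f i) x) y) \<le> C) F"
  shows "\<exists>T. limitin wot f T F"
proof -
  note uniq = tendsto_unique[OF assms(1) lim]
  have "\<exists>T. \<forall>x y. B x y = cinner (bop_apply T x) y"
  proof (rule bounded_form_representation)
    show "B (x + x') y = B x y + B x' y" for x x' y
      by (rule uniq) (simp add: bop_apply_add cinner_add_left tendsto_add lim)
    show "B x (y + y') = B x y + B x y'" for x y y'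
      by (rule uniq) (simp add: cinner_add_right tendsto_add lim)
    show "B (c *\<^sub>C x) y = c * B x y" for c x y
      by (rule uniq) (simp add: bop_apply_scaleC cinner_scaleC_left tendsto_mult_left lim)
    show "B x (c *\<^sub>C y) = cnj c * B x y" for c x y
      by (rule uniq) (simp add: cinner_scaleC_right tendsto_mult_left lim)
    show "cmod (B x y) \<le> C" if "norm x \<le> 1" "norm y \<le> 1" for x y
      by (rule tendsto_upperbound[OF tendsto_norm[OF lim] _ assms(1)]) (simp add: bound that)
  qed
  then obtain T where T: "\<forall>x y. B x y = cinner (bop_apply T x) y" by blast
  have "limitin wot f T F" using lim T by (simp add: limitin_wot_iff)
  then show ?thesis ..
qed

text \<open>Weak compactness of norm balls: the matrix coefficients of all \<open>f i\<close> lie in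
  one product of closed discs, compact by Tychonoff. The cluster point comes with a finer filter
  \<open>G\<close> instead of a subsequence, so the limit lemmas apply to it directly.\<close>

lemma wot_cluster_point:
  fixes f :: "nat \<Rightarrow> 'h::complex_hilbert_space bop"
  assumes "0 \<le> K" and bound: "\<And>i x. norm (bop_apply (f i) x) \<le> K * norm x"
  shows "\<exists>G T. G \<le> sequentially \<and> G \<noteq> bot \<and> limitin wot f T G"
proof -
  define g where "g = (\<lambda>i (x, y). cinner (bop_apply (f i) x) y)"
  define U where "U = PiE UNIV (\<lambda>(x :: 'h, y :: 'h). cball (0 :: complex) (K * norm x * norm y))"
  have bd: "cmod (cinner (bop_apply (f i) x) y) \<le> K * norm x * norm y" for i x y
    using Cauchy_Schwarz_cinner mult_right_mono[OF bound norm_ge_zero] by (rule order_trans)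
  have "compactin euclidean U"
    unfolding U_def euclidean_product_topology[symmetric] compactin_PiE by auto
  then have "compact U" by simp
  moreover have "eventually (\<lambda>z. z \<in> U) (filtermap g sequentially)"
    by (simp add: eventually_filtermap U_def g_def bd PiE_iff split_beta)
  moreover have "filtermap g sequentially \<noteq> bot" by (simp add: filtermap_bot_iff)
  ultimately obtain b where b: "inf (nhds b) (filtermap g sequentially) \<noteq> bot"
    unfolding compact_filter by blast
  \<comment> \<open>\<open>G\<close> consists of the tails of the sequence cut down to the indices
    whose coefficients are near \<open>b\<close>. That \<open>b\<close> is a cluster point says
    exactly that \<open>G\<close> is proper.\<close>
  define G where "G = inf (filtercomap g (nhds b)) sequentially"
  have "G \<noteq> bot"
  proof
    assume "G = bot"
    then have "eventually (\<lambda>_. False) G" by simp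
    then obtain P R where P: "eventually P (filtercomap g (nhds b))"
      and R: "eventually R sequentially" and PR: "\<And>i. P i \<Longrightarrow> R i \<Longrightarrow> False"
      unfolding G_def eventually_inf by blast
    obtain P' where P': "eventually P' (nhds b)" "\<And>i. P' (g i) \<Longrightarrow> P i"
      using P unfolding eventually_filtercomap by blast
    have "eventually (\<lambda>z. \<not> P' z) (filtermap g sequentially)"
      unfolding eventually_filtermap using R by (rule eventually_mono) (use P' PR in blast)
    with P'(1) have "eventually (\<lambda>_. False) (inf (nhds b) (filtermap g sequentially))"
      unfolding eventually_inf by blast
    with b show False by (simp add: eventually_False)
  qed
  moreover have "G \<le> sequentially" by (simp add: G_def)
  moreover have "filterlim g (nhds b) G"
    using filterlim_filtercomap[of g "nhds b"] unfolding G_def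
    by (rule filterlim_mono) simp_all
  then have "limitin euclidean g b G" by simp
  then have lim: "((\<lambda>i. g i z) \<longlongrightarrow> b z) G" for z
    unfolding euclidean_product_topology[symmetric] limitin_componentwise by (cases z) simp
  have "\<exists>T. limitin wot f T G"
  proof (rule limitin_wot_exists[OF \<open>G \<noteq> bot\<close>])
    show "((\<lambda>i. cinner (bop_apply (f i) x) y) \<longlongrightarrow> b (x, y)) G" for x y
      using lim[of "(x, y)"] by (simp add: g_def)
    show "eventually (\<lambda>i. cmod (cinner (bop_apply (f i) x) y) \<le> K) G"
      if "norm x \<le> 1" "norm y \<le> 1" for x y
    proof (rule always_eventually, rule allI)
      fix i
      have "K * norm x * norm y \<le> K * 1 * 1"
        using that assms(1) by (intro mult_mono) auto
      with bd[of i x y] show "cmod (cinner (bop_apply (f i) x) y) \<le> K" by simp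
    qed
  qed
  ultimately show ?thesis by blast
qed

section \<open>The maps \<open>\<Phi>\<close>\<close>

lemma sum_bop_apply: "bop_apply (\<Sum>i\<in>I. f i) x = (\<Sum>i\<in>I. bop_apply (f i) x)"
  by (induction I rule: infinite_finite_induct) (simp_all add: bop_apply_simps)

lemma has_wot_sum_cong:
  assumes "\<And>i. i \<in> I \<Longrightarrow> f i = g i"
  shows "has_wot_sum f I S \<longleftrightarrow> has_wot_sum g I S"
proof -
  have "has_wot_sum f I S" if "\<And>i. i \<in> I \<Longrightarrow> f i = g i" "has_wot_sum g I S" for f g
    unfolding has_wot_sum_def
    by (rule limitin_transform_eventually[OF _ that(2)[unfolded has_wot_sum_def]])
      (auto intro!: eventually_finite_subsets_at_top_weakI sum.cong simp: that(1) subset_iff)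
  then show ?thesis using assms by metis
qed

lemma has_wot_sum_unique: "has_wot_sum f I S \<Longrightarrow> has_wot_sum f I T \<Longrightarrow> S = T"
  unfolding has_wot_sum_def by (rule limitin_wot_unique) simp_all

lemma Phi_eqI:
  assumes "has_wot_sum (\<lambda>\<alpha>. a \<alpha> *\<^sub>R (word_op X \<alpha> * Y * adj (word_op X \<alpha>))) (words n) S"
  shows "Phi n a X Y = S"
  unfolding Phi_def by (rule the_equality, rule assms, rule has_wot_sum_unique[OF _ assms])

lemma word_op_commute:
  assumes "\<And>j l. j \<in> {1..n} \<Longrightarrow> l \<in> {1..n'} \<Longrightarrow> X j * X' l = X' l * X j"
    and "\<alpha> \<in> words n" and "\<beta> \<in> words n'"
  shows "word_op X \<alpha> * word_op X' \<beta> = word_op X' \<beta> * word_op X \<alpha>"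
proof -
  have "X j * word_op X' \<beta> = word_op X' \<beta> * X j" if "j \<in> {1..n}" for j
    using assms(3) unfolding words_def word_op_def
  proof (induction \<beta>)
    case (Cons l \<beta>)
    have "X j * prod_list (map X' (l # \<beta>)) = X' l * (X j * prod_list (map X' \<beta>))"
      using assms(1)[OF that, of l] Cons.hyps(1) by (simp flip: mult.assoc)
    with Cons.IH show ?case by (simp add: mult.assoc)
  qed simp
  note * = this
  show ?thesis
    using assms(2) unfolding words_def word_op_def[of X]
  proof (induction \<alpha>)
    case (Cons j \<alpha>)
    have "prod_list (map X (j # \<alpha>)) * word_op X' \<beta> = X j * word_op X' \<beta> * prod_list (map X \<alpha>)"
      using Cons.IH by (simp add: mult.assoc)
    with *[of j] Cons.hyps(1) show ?case by (simp add: mult.assoc)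
  qed simp
qed

lemma von_neumann_algebra_sum:
  assumes "von_neumann_algebra M" and "\<And>i. i \<in> I \<Longrightarrow> f i \<in> M"
  shows "(\<Sum>i\<in>I. f i) \<in> M"
proof -
  have "(0 :: complex) *\<^sub>C 1 \<in> M" using assms(1) unfolding von_neumann_algebra_def by blast
  moreover have "(0 :: complex) *\<^sub>C T = 0" for T :: "'a bop"
    by (metis scaleC_of_real of_real_0 scaleR_zero_left)
  ultimately have "0 \<in> M" by simp
  with assms show ?thesis
    by (induction I rule: infinite_finite_induct) (auto simp: von_neumann_algebra_def)
qed

context
  fixes n :: nat and a :: "nat list \<Rightarrow> real" and X :: "nat \<Rightarrow> 'h::complex_hilbert_space bop"
  assumes nonneg: "\<And>\<alpha>. \<alpha> \<in> words n \<Longrightarrow> 0 \<le> a \<alpha>"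
    and wd: "Phi_well_defined n a X"
begin

text \<open>Well-definedness speaks only of \<open>Y = 1\<close>, where the diagonal coefficients
  form the convergent nonnegative series \<open>h x\<close>. For arbitrary \<open>Y\<close> the
  coefficient at \<open>x\<close>, \<open>y\<close> is dominated termwise by
  \<open>K * (h x \<alpha> + h y \<alpha>)\<close>. This makes the definite description
  \<open>Phi\<close> meaningful on all operators.\<close>

lemma has_wot_sum_Phi:
  "has_wot_sum (\<lambda>\<alpha>. a \<alpha> *\<^sub>R (word_op X \<alpha> * Y * adj (word_op X \<alpha>))) (words n) (Phi n a X Y)"
proof -
  let ?W = "word_op X"
  let ?f = "\<lambda>\<alpha>. a \<alpha> *\<^sub>R (?W \<alpha> * Y * adj (?W \<alpha>))"
  obtain S where "has_wot_sum (\<lambda>\<alpha>. a \<alpha> *\<^sub>R (?W \<alpha> * adj (?W \<alpha>))) (words n) S"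
    using wd unfolding Phi_well_defined_def by blast
  then have S: "((\<lambda>\<alpha>. cinner (bop_apply (a \<alpha> *\<^sub>R (?W \<alpha> * adj (?W \<alpha>))) x) y)
      has_sum cinner (bop_apply S x) y) (words n)" for x y
    unfolding has_wot_sum_def limitin_wot_iff has_sum_def
    by (simp add: bop_eqI cinner_sum_left sum_bop_apply)
  define h where "h x \<alpha> = a \<alpha> * (norm (bop_apply (adj (?W \<alpha>)) x))\<^sup>2" for x \<alpha>
  have h: "(h x has_sum Re (cinner (bop_apply S x) x)) (words n)" for x
    using has_sum_Re[OF S[of x x]]
    by (simp add: h_def[abs_def] bop_apply_simps cinner_scaleR_left
        cinner_adj_right[where T = "?W \<alpha>" for \<alpha>] Re_cinner_self)
  obtain K where K: "0 < K" "\<And>u. norm (bop_apply Y u) \<le> K * norm u"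
    using bop_bounded[of Y] by auto
  have term_bound: "cmod (cinner (bop_apply (?f \<alpha>) x) y) \<le> K * (h x \<alpha> + h y \<alpha>)"
    if "\<alpha> \<in> words n" for \<alpha> x y
  proof -
    let ?u = "bop_apply (adj (?W \<alpha>)) x" and ?v = "bop_apply (adj (?W \<alpha>)) y"
    have "cmod (cinner (bop_apply Y ?u) ?v) \<le> norm (bop_apply Y ?u) * norm ?v"
      by (rule Cauchy_Schwarz_cinner)
    also have "\<dots> \<le> K * norm ?u * norm ?v" by (intro mult_right_mono K(2)) simp
    also have "\<dots> \<le> K * ((norm ?u)\<^sup>2 + (norm ?v)\<^sup>2)"
    proof -
      have "0 \<le> (norm ?u - norm ?v)\<^sup>2 + (norm ?u)\<^sup>2 + (norm ?v)\<^sup>2" by simp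
      then have "norm ?u * norm ?v \<le> (norm ?u)\<^sup>2 + (norm ?v)\<^sup>2"
        by (simp add: power2_eq_square algebra_simps)
      then show ?thesis using K(1) by simp
    qed
    finally have "a \<alpha> * cmod (cinner (bop_apply Y ?u) ?v) \<le> a \<alpha> * (K * ((norm ?u)\<^sup>2 + (norm ?v)\<^sup>2))"
      by (rule mult_left_mono) (rule nonneg[OF that])
    then show ?thesis
      using nonneg[OF that]
      by (simp add: h_def bop_apply_simps cinner_scaleR_left cinner_adj_right norm_mult algebra_simps)
  qed
  define B where "B x y = (\<Sum>\<^sub>\<infinity>\<alpha>\<in>words n. cinner (bop_apply (?f \<alpha>) x) y)" for x y
  have "((\<lambda>\<alpha>. cinner (bop_apply (?f \<alpha>) x) y) has_sum B x y) (words n)" for x y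
    unfolding B_def
  proof (rule has_sum_infsum, rule abs_summable_summable, rule summable_on_comparison_test)
    show "(\<lambda>\<alpha>. K * (h x \<alpha> + h y \<alpha>)) summable_on words n"
      using h by (intro summable_on_cmult_right summable_on_add) (auto simp: summable_on_def)
  qed (use term_bound in auto)
  then have lim: "((\<lambda>F. cinner (bop_apply (\<Sum>\<alpha>\<in>F. ?f \<alpha>) x) y) \<longlongrightarrow> B x y)
      (finite_subsets_at_top (words n))" for x y
    unfolding has_sum_def by (simp add: cinner_sum_left sum_bop_apply)
  \<comment> \<open>Convergence of each coefficient is settled; a bound \<open>K * (r + r)\<close>
    uniform over finite sets and unit vectors is still needed to obtain an operator.\<close>
  obtain r where r: "0 < r" "\<And>u. norm (bop_apply S u) \<le> r * norm u"
    using bop_bounded[of S] by auto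
  have "\<exists>T. limitin wot (\<lambda>F. \<Sum>\<alpha>\<in>F. ?f \<alpha>) T (finite_subsets_at_top (words n))"
  proof (rule limitin_wot_exists[OF _ lim])
    fix x y :: 'h assume xy: "norm x \<le> 1" "norm y \<le> 1"
    have Sr: "Re (cinner (bop_apply S u) u) \<le> r" if "norm u \<le> 1" for u
    proof -
      have "Re (cinner (bop_apply S u) u) \<le> norm (bop_apply S u) * norm u"
        using complex_Re_le_cmod Cauchy_Schwarz_cinner by (rule order_trans)
      also have "\<dots> \<le> (r * norm u) * norm u" by (intro mult_right_mono r(2)) simp
      also have "\<dots> \<le> (r * 1) * 1" using that r(1) by (intro mult_mono) auto
      finally show ?thesis by simp
    qed
    show "eventually (\<lambda>F. cmod (cinner (bop_apply (\<Sum>\<alpha>\<in>F. ?f \<alpha>) x) y) \<le> K * (r + r))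
        (finite_subsets_at_top (words n))"
    proof (rule eventually_finite_subsets_at_top_weakI)
      fix F assume F: "finite F" "F \<subseteq> words n"
      have "cmod (cinner (bop_apply (\<Sum>\<alpha>\<in>F. ?f \<alpha>) x) y) =
          cmod (\<Sum>\<alpha>\<in>F. cinner (bop_apply (?f \<alpha>) x) y)"
        by (simp add: cinner_sum_left sum_bop_apply)
      also have "\<dots> \<le> (\<Sum>\<alpha>\<in>F. K * (h x \<alpha> + h y \<alpha>))"
        by (rule sum_norm_le) (use term_bound F in blast)
      also have "\<dots> = K * ((\<Sum>\<alpha>\<in>F. h x \<alpha>) + (\<Sum>\<alpha>\<in>F. h y \<alpha>))"
        by (simp add: sum_distrib_left[symmetric] sum.distrib)
      also have "\<dots> \<le> K * (r + r)"
      proof -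
        have "(\<Sum>\<alpha>\<in>F. h u \<alpha>) \<le> r" if "norm u \<le> 1" for u
        proof -
          have "(\<Sum>\<alpha>\<in>F. h u \<alpha>) \<le> Re (cinner (bop_apply S u) u)"
            by (rule finite_sum_le_has_sum[OF h F]) (simp add: h_def nonneg)
          with Sr[OF that] show ?thesis by simp
        qed
        then show ?thesis using K(1) xy by (intro mult_left_mono add_mono) auto
      qed
      finally show "cmod (cinner (bop_apply (\<Sum>\<alpha>\<in>F. ?f \<alpha>) x) y) \<le> K * (r + r)" .
    qed
  qed simp
  then obtain T where T: "has_wot_sum ?f (words n) T"
    unfolding has_wot_sum_def by blast
  then show ?thesis using Phi_eqI by metis
qed

lemma linear_Phi: "linear (Phi n a X)"
proof (rule linearI)
  fix Y Z :: "'h bop" and r :: real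
  show "Phi n a X (Y + Z) = Phi n a X Y + Phi n a X Z"
  proof (rule Phi_eqI)
    show "has_wot_sum (\<lambda>\<alpha>. a \<alpha> *\<^sub>R (word_op X \<alpha> * (Y + Z) * adj (word_op X \<alpha>))) (words n)
        (Phi n a X Y + Phi n a X Z)"
      using limitin_wot_add[OF has_wot_sum_Phi[unfolded has_wot_sum_def, of Y]
          has_wot_sum_Phi[unfolded has_wot_sum_def, of Z]]
      unfolding has_wot_sum_def
      by (simp add: distrib_left distrib_right scaleR_add_right sum.distrib[symmetric])
  qed
  show "Phi n a X (r *\<^sub>R Y) = r *\<^sub>R Phi n a X Y"
  proof (rule Phi_eqI)
    show "has_wot_sum (\<lambda>\<alpha>. a \<alpha> *\<^sub>R (word_op X \<alpha> * (r *\<^sub>R Y) * adj (word_op X \<alpha>))) (words n)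
        (r *\<^sub>R Phi n a X Y)"
      using limitin_wot_scaleR[OF has_wot_sum_Phi[unfolded has_wot_sum_def, of Y], of "\<lambda>_. r" r]
      unfolding has_wot_sum_def
      by (simp add: scaleR_sum_right mult.commute)
  qed
qed

text \<open>With \<open>Phi_partial_sum_le\<close>, this presents \<open>Phi\<close> at a positive
  operator as the supremum of its finite partial sums. The two facts take the place of continuity
  when \<open>Phi\<close> meets a limit or another series.\<close>

lemma Phi_leI:
  assumes "\<And>F. finite F \<Longrightarrow> F \<subseteq> words n \<Longrightarrow>
    (\<Sum>\<alpha>\<in>F. a \<alpha> *\<^sub>R (word_op X \<alpha> * Y * adj (word_op X \<alpha>))) \<le> Z"
  shows "Phi n a X Y \<le> Z"
  by (rule limitin_wot_le[OF _ has_wot_sum_Phi[unfolded has_wot_sum_def], where g = "\<lambda>_. Z"])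
    (auto intro: eventually_finite_subsets_at_top_weakI assms)

lemma Phi_partial_sum_le:
  assumes "0 \<le> Y" and "finite F" and "F \<subseteq> words n"
  shows "(\<Sum>\<alpha>\<in>F. a \<alpha> *\<^sub>R (word_op X \<alpha> * Y * adj (word_op X \<alpha>))) \<le> Phi n a X Y"
proof (rule limitin_wot_le[OF _ _ has_wot_sum_Phi[unfolded has_wot_sum_def]])
  let ?f = "\<lambda>\<alpha>. a \<alpha> *\<^sub>R (word_op X \<alpha> * Y * adj (word_op X \<alpha>))"
  have "0 \<le> ?f \<alpha>" if "\<alpha> \<in> words n" for \<alpha>
    using conjugate_mono[OF assms(1), of "word_op X \<alpha>"] nonneg[OF that]
    by (simp add: scaleR_nonneg_nonneg)
  then have "(\<Sum>\<alpha>\<in>F. ?f \<alpha>) \<le> (\<Sum>\<alpha>\<in>F'. ?f \<alpha>)" if "finite F'" "F \<subseteq> F'" "F' \<subseteq> words n" for F'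
    using that by (intro sum_mono2) auto
  with assms(2,3) show "eventually (\<lambda>F'. (\<Sum>\<alpha>\<in>F. ?f \<alpha>) \<le> (\<Sum>\<alpha>\<in>F'. ?f \<alpha>)) (finite_subsets_at_top (words n))"
    unfolding eventually_finite_subsets_at_top by blast
qed simp_all

lemma Phi_nonneg:
  assumes "0 \<le> Y"
  shows "0 \<le> Phi n a X Y"
  using Phi_partial_sum_le[OF assms, of "{}"] by simp

lemma Phi_mono:
  assumes "Y \<le> Z"
  shows "Phi n a X Y \<le> Phi n a X Z"
  using Phi_nonneg[of "Z - Y"] assms linear_diff[OF linear_Phi] by simp

text \<open>Conjugation by a fixed operator is weakly continuous, so it passes through the series.
  The right-hand factors are moved by the adjoint of the commutation relation, without
  \<open>C\<close> commuting with any adjoint of a word.\<close>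

lemma Phi_conjugate:
  assumes "\<And>\<alpha>. \<alpha> \<in> words n \<Longrightarrow> word_op X \<alpha> * C = C * word_op X \<alpha>"
  shows "Phi n a X (C * Y * adj C) = C * Phi n a X Y * adj C"
proof (rule Phi_eqI)
  have *: "word_op X \<alpha> * (C * Y * adj C) * adj (word_op X \<alpha>) =
      C * (word_op X \<alpha> * Y * adj (word_op X \<alpha>)) * adj C" if "\<alpha> \<in> words n" for \<alpha>
  proof -
    have "word_op X \<alpha> * (C * Y * adj C) * adj (word_op X \<alpha>) =
        (word_op X \<alpha> * C) * Y * adj (word_op X \<alpha> * C)"
      by (simp add: adj_mult mult.assoc)
    also have "\<dots> = (C * word_op X \<alpha>) * Y * adj (C * word_op X \<alpha>)"
      by (simp only: assms[OF that])
    finally show ?thesis by (simp add: adj_mult mult.assoc)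
  qed
  have "limitin wot (\<lambda>F. \<Sum>\<alpha>\<in>F. C * (a \<alpha> *\<^sub>R (word_op X \<alpha> * Y * adj (word_op X \<alpha>))) * adj C)
      (C * Phi n a X Y * adj C) (finite_subsets_at_top (words n))"
    using limitin_wot_mult[OF has_wot_sum_Phi[unfolded has_wot_sum_def], of C Y "adj C"]
    by (simp only: sum_distrib_left sum_distrib_right)
  then show "has_wot_sum (\<lambda>\<alpha>. a \<alpha> *\<^sub>R (word_op X \<alpha> * (C * Y * adj C) * adj (word_op X \<alpha>)))
      (words n) (C * Phi n a X Y * adj C)"
    by (subst has_wot_sum_cong) (auto simp: * has_wot_sum_def)
qed

lemma Phi_in_von_neumann_algebra:
  assumes M: "von_neumann_algebra M" and X: "\<And>j. j \<in> {1..n} \<Longrightarrow> X j \<in> M" and Y: "Y \<in> M"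
  shows "Phi n a X Y \<in> M"
proof (rule limitin_closedin[OF has_wot_sum_Phi[unfolded has_wot_sum_def]])
  show "closedin wot M" using M by (simp add: von_neumann_algebra_def)
  have word: "word_op X \<alpha> \<in> M" if "\<alpha> \<in> words n" for \<alpha>
    using that unfolding words_def word_op_def
    by (induction \<alpha>) (use M X in \<open>auto simp: von_neumann_algebra_def\<close>)
  have "a \<alpha> *\<^sub>R (word_op X \<alpha> * Y * adj (word_op X \<alpha>)) \<in> M" if "\<alpha> \<in> words n" for \<alpha>
    using M word[OF that] Y
    by (simp add: von_neumann_algebra_def scaleC_of_real[symmetric])
  then show "eventually (\<lambda>F. (\<Sum>\<alpha>\<in>F. a \<alpha> *\<^sub>R (word_op X \<alpha> * Y * adj (word_op X \<alpha>))) \<in> M)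
      (finite_subsets_at_top (words n))"
    by (intro eventually_finite_subsets_at_top_weakI von_neumann_algebra_sum[OF M]) auto
qed simp

end

text \<open>A finite partial sum of the outer series commutes with the inner map, so each of the two
  compositions is a limit of operators dominated by the other one.\<close>

lemma Phi_commute:
  fixes X X' :: "nat \<Rightarrow> 'h::complex_hilbert_space bop"
  assumes a: "\<And>\<alpha>. \<alpha> \<in> words n \<Longrightarrow> 0 \<le> a \<alpha>" "Phi_well_defined n a X"
    and a': "\<And>\<alpha>. \<alpha> \<in> words n' \<Longrightarrow> 0 \<le> a' \<alpha>" "Phi_well_defined n' a' X'"
    and comm: "\<And>j l. j \<in> {1..n} \<Longrightarrow> l \<in> {1..n'} \<Longrightarrow> X j * X' l = X' l * X j"
    and Y: "0 \<le> Y"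
  shows "Phi n a X (Phi n' a' X' Y) = Phi n' a' X' (Phi n a X Y)"
proof -
  \<comment> \<open>Stated for arbitrary data, so that it can be used again with the two maps
    exchanged.\<close>
  have *: "Phi n a X (Phi n' a' X' Y) \<le> Phi n' a' X' (Phi n a X Y)"
    if a: "\<And>\<alpha>. \<alpha> \<in> words n \<Longrightarrow> 0 \<le> a \<alpha>" "Phi_well_defined n a X"
      and a': "\<And>\<alpha>. \<alpha> \<in> words n' \<Longrightarrow> 0 \<le> a' \<alpha>" "Phi_well_defined n' a' X'"
      and comm: "\<And>j l. j \<in> {1..n} \<Longrightarrow> l \<in> {1..n'} \<Longrightarrow> X j * X' l = X' l * X j"
    for n n' a a' and X X' :: "nat \<Rightarrow> 'h bop"
  proof (rule Phi_leI[OF a])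
    fix F assume F: "finite F" "F \<subseteq> words n"
    let ?f = "\<lambda>Y \<alpha>. a \<alpha> *\<^sub>R (word_op X \<alpha> * Y * adj (word_op X \<alpha>))"
    have lin: "linear (Phi n' a' X')" by (rule linear_Phi[OF a'])
    have "?f (Phi n' a' X' Y) \<alpha> = Phi n' a' X' (?f Y \<alpha>)" if "\<alpha> \<in> F" for \<alpha>
    proof -
      have "Phi n' a' X' (word_op X \<alpha> * Y * adj (word_op X \<alpha>)) =
          word_op X \<alpha> * Phi n' a' X' Y * adj (word_op X \<alpha>)"
      proof (rule Phi_conjugate[OF a'])
        fix \<beta> assume "\<beta> \<in> words n'"
        with that F(2) show "word_op X' \<beta> * word_op X \<alpha> = word_op X \<alpha> * word_op X' \<beta>"
          by (intro word_op_commute[symmetric, OF comm]) auto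
      qed
      then show ?thesis by (simp add: linear_scale[OF lin])
    qed
    then have "(\<Sum>\<alpha>\<in>F. ?f (Phi n' a' X' Y) \<alpha>) = Phi n' a' X' (\<Sum>\<alpha>\<in>F. ?f Y \<alpha>)"
      by (simp add: linear_sum[OF lin])
    also have "\<dots> \<le> Phi n' a' X' (Phi n a X Y)"
      by (intro Phi_mono[OF a'] Phi_partial_sum_le[OF a] Y F)
    finally show "(\<Sum>\<alpha>\<in>F. ?f (Phi n' a' X' Y) \<alpha>) \<le> Phi n' a' X' (Phi n a X Y)" .
  qed
  show ?thesis
    by (intro antisym * a a') (use comm in auto)
qed

section \<open>Averages of commuting positive maps\<close>

lemma compose_upto_0 [simp]: "compose_upto 0 F = id"
  by (simp add: compose_upto_def)

lemma compose_downto_0 [simp]: "compose_downto 0 F = id"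
  by (simp add: compose_downto_def)

lemma compose_upto_Suc: "compose_upto (Suc k) F y = compose_upto k F (F (Suc k) y)"
proof -
  have "foldr (\<circ>) fs g = foldr (\<circ>) fs id \<circ> g" for fs and g :: "'a \<Rightarrow> 'a"
    by (induction fs) auto
  from this[of "map F [1..<Suc k]" "F (Suc k)"] show ?thesis
    by (simp add: compose_upto_def)
qed

lemma compose_downto_Suc: "compose_downto (Suc k) F y = F (Suc k) (compose_downto k F y)"
  by (simp add: compose_downto_def)

text \<open>An invariance principle; \<open>C\<close> will be the positive cone, or a small set such
  as \<open>{0, 1}\<close> or \<open>{Q}\<close> when the value itself is wanted.\<close>

lemma compose_upto_in:
  assumes "\<And>i y. i \<in> {1..k} \<Longrightarrow> y \<in> C \<Longrightarrow> F i y \<in> C" and "y \<in> C"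
  shows "compose_upto k F y \<in> C"
  using assms by (induction k arbitrary: y) (auto simp: compose_upto_Suc)

lemma compose_downto_in:
  assumes "\<And>i y. i \<in> {1..k} \<Longrightarrow> y \<in> C \<Longrightarrow> F i y \<in> C" and "y \<in> C"
  shows "compose_downto k F y \<in> C"
  using assms by (induction k) (auto simp: compose_downto_Suc)

lemma compose_downto_cong:
  assumes "\<And>i. i \<in> {1..k} \<Longrightarrow> F i = G i"
  shows "compose_downto k F y = compose_downto k G y"
  using assms by (induction k) (auto simp: compose_downto_Suc)

lemma compose_downto_commute:
  assumes "\<And>i y. i \<in> {1..k} \<Longrightarrow> y \<in> C \<Longrightarrow> F i y \<in> C"
    and "\<And>i y. i \<in> {1..k} \<Longrightarrow> y \<in> C \<Longrightarrow> g (F i y) = F i (g y)"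
    and "y \<in> C"
  shows "g (compose_downto k F y) = compose_downto k F (g y)"
  using assms(1,2)
proof (induction k)
  case (Suc k)
  have "compose_downto k F y \<in> C"
    by (rule compose_downto_in) (use Suc.prems(1) assms(3) in auto)
  then show ?case using Suc by (simp add: compose_downto_Suc)
qed simp

text \<open>Reconciles the composition order of (ii) with that of (iii). Commutation is available
  only on \<open>C\<close>, so each exchange needs its argument to stay there.\<close>

lemma compose_upto_eq_downto:
  assumes "\<And>i y. i \<in> {1..k} \<Longrightarrow> y \<in> C \<Longrightarrow> F i y \<in> C"
    and "\<And>i j y. i \<in> {1..k} \<Longrightarrow> j \<in> {1..k} \<Longrightarrow> y \<in> C \<Longrightarrow> F i (F j y) = F j (F i y)"
    and "y \<in> C"
  shows "compose_upto k F y = compose_downto k F y"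
  using assms
proof (induction k arbitrary: y)
  case (Suc k)
  have "compose_upto (Suc k) F y = compose_downto k F (F (Suc k) y)"
    using Suc by (simp add: compose_upto_Suc)
  also have "\<dots> = F (Suc k) (compose_downto k F y)"
    by (rule compose_downto_commute[symmetric, where C = C]) (use Suc.prems in auto)
  finally show ?case by (simp add: compose_downto_Suc)
qed simp

text \<open>Brings one map to the outermost place, which prepares summation along a single axis of
  the box.\<close>

lemma compose_downto_extract:
  assumes "\<And>i y. i \<in> {1..k} \<Longrightarrow> y \<in> C \<Longrightarrow> F i y \<in> C"
    and "\<And>i j y. i \<in> {1..k} \<Longrightarrow> j \<in> {1..k} \<Longrightarrow> y \<in> C \<Longrightarrow> F i (F j y) = F j (F i y)"
    and "y \<in> C" and "i \<in> {1..k}"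
  shows "compose_downto k F y = F i (compose_downto k (F(i := id)) y)"
  using assms
proof (induction k)
  case (Suc k)
  show ?case
  proof (cases "i = Suc k")
    case True
    have "compose_downto k F y = compose_downto k (F(i := id)) y"
      by (rule compose_downto_cong) (use True in auto)
    then show ?thesis unfolding compose_downto_Suc using True by (metis fun_upd_same id_apply)
  next
    case False
    have "compose_downto k (F(i := id)) y \<in> C"
      by (rule compose_downto_in) (use Suc.prems in auto)
    then have "F (Suc k) (F i (compose_downto k (F(i := id)) y)) =
        F i (F (Suc k) (compose_downto k (F(i := id)) y))"
      using Suc.prems by (intro Suc.prems(2)) auto
    moreover have "compose_downto k F y = F i (compose_downto k (F(i := id)) y)"
      using Suc.prems False by (intro Suc.IH) auto
    ultimately show ?thesis unfolding compose_downto_Suc using False by (metis fun_upd_other)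
  qed
qed simp

lemma positive_linear_mono:
  fixes f :: "'b::ordered_real_vector \<Rightarrow> 'c::ordered_real_vector"
  assumes "linear f" and "\<And>y. 0 \<le> y \<Longrightarrow> 0 \<le> f y" and "x \<le> y"
  shows "f x \<le> f y"
  using assms(2)[of "y - x"] assms(3) by (simp add: linear_diff[OF assms(1)])

text \<open>The averaging estimates use only linearity and order. Commutation is restricted to the
  positive cone because the supremum argument for \<open>Phi\<close> delivers it there.\<close>

locale commuting_positive_maps =
  fixes k :: nat and \<phi> :: "nat \<Rightarrow> 'b::ordered_real_vector \<Rightarrow> 'b"
  assumes linear: "i \<in> {1..k} \<Longrightarrow> linear (\<phi> i)"
    and nonneg: "i \<in> {1..k} \<Longrightarrow> 0 \<le> y \<Longrightarrow> 0 \<le> \<phi> i y"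
    and commute: "i \<in> {1..k} \<Longrightarrow> j \<in> {1..k} \<Longrightarrow> 0 \<le> y \<Longrightarrow> \<phi> i (\<phi> j y) = \<phi> j (\<phi> i y)"
begin

lemma linear_funpow: "i \<in> {1..k} \<Longrightarrow> linear (\<phi> i ^^ t)"
  by (induction t) (auto intro: linear_compose[OF _ linear] simp: linear_id[unfolded id_def] id_def)

lemma nonneg_funpow: "i \<in> {1..k} \<Longrightarrow> 0 \<le> y \<Longrightarrow> 0 \<le> (\<phi> i ^^ t) y"
  by (induction t) (auto intro: nonneg)

lemma mono_funpow: "i \<in> {1..k} \<Longrightarrow> x \<le> y \<Longrightarrow> (\<phi> i ^^ t) x \<le> (\<phi> i ^^ t) y"
  by (rule positive_linear_mono[OF linear_funpow nonneg_funpow])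

lemma commute_funpow:
  assumes "i \<in> {1..k}" and "j \<in> {1..k}" and "0 \<le> y"
  shows "(\<phi> i ^^ s) ((\<phi> j ^^ t) y) = (\<phi> j ^^ t) ((\<phi> i ^^ s) y)"
proof -
  have *: "\<phi> i ((\<phi> j ^^ t) y) = (\<phi> j ^^ t) (\<phi> i y)" if "0 \<le> y" for y
    using that by (induction t) (auto simp: commute[OF assms(1,2)] nonneg_funpow[OF assms(2)])
  show ?thesis
    by (induction s) (auto simp: * nonneg_funpow[OF assms(1)] assms(3))
qed

lemma compose_upto_funpow_eq_downto:
  assumes "0 \<le> e"
  shows "compose_upto k (\<lambda>i. \<phi> i ^^ s i) e = compose_downto k (\<lambda>i. \<phi> i ^^ s i) e"
  by (rule compose_upto_eq_downto[where C = "{y. 0 \<le> y}"])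
    (use assms in \<open>auto intro: nonneg_funpow commute_funpow\<close>)

text \<open>The numerator of the Cesaro mean; without the normalizing factor, boxes can be sliced
  and shifted exactly.\<close>

definition box_sum :: "(nat \<Rightarrow> nat) \<Rightarrow> 'b \<Rightarrow> 'b" where
  "box_sum p e = (\<Sum>s\<in>PiE {1..k} (\<lambda>i. {..<p i}). compose_downto k (\<lambda>i. \<phi> i ^^ s i) e)"

text \<open>The box has a single multi-index, 0 on \<open>{1..k}\<close> and
  \<open>undefined\<close> elsewhere; the composition never reads the latter values.\<close>

lemma box_sum_one: "box_sum (\<lambda>_. 1) e = e"
proof -
  have "PiE {1..k} (\<lambda>_. {..<1::nat}) = {\<lambda>i\<in>{1..k}. 0}"
    using PiE_singleton[of "\<lambda>i\<in>{1..k}. 0::nat" "{1..k}"]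
    by (simp add: lessThan_Suc cong: PiE_cong)
  moreover have "compose_downto k (\<lambda>i. \<phi> i ^^ (if i \<in> {1..k} then 0 else undefined)) e \<in> {e}"
    by (rule compose_downto_in) auto
  ultimately show ?thesis by (simp add: box_sum_def restrict_def)
qed

text \<open>Slice the box across axis \<open>i\<close>. The box for \<open>p(i := 1)\<close> is the
  face \<open>s i = 0\<close>, and the slice \<open>s i = t\<close> contributes the image of the
  face sum under the \<open>t\<close>-th power of \<open>\<phi> i\<close>.\<close>

lemma box_sum_extract:
  assumes "i \<in> {1..k}" and "0 \<le> e"
  shows "box_sum p e = (\<Sum>t<p i. (\<phi> i ^^ t) (box_sum (p(i := 1)) e))"
proof -
  let ?c = "\<lambda>s. compose_downto k (\<lambda>i. \<phi> i ^^ s i) e"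
  \<comment> \<open>An exponent 0 gives \<open>id\<close>, so resetting \<open>s i\<close> to 0 is
    the removal of \<open>\<phi> i\<close> in \<open>compose_downto_extract\<close>.\<close>
  have pull: "?c s = (\<phi> i ^^ s i) (?c (s(i := 0)))" for s
  proof -
    have "(\<lambda>j. \<phi> j ^^ (s(i := 0)) j) = (\<lambda>j. \<phi> j ^^ s j)(i := id)"
      by (auto simp: fun_eq_iff)
    then show ?thesis
      using compose_downto_extract[where F = "\<lambda>j. \<phi> j ^^ s j" and C = "{y. 0 \<le> y}" and i = i and y = e]
        assms nonneg_funpow commute_funpow by auto
  qed
  have "(\<Sum>t<p i. (\<phi> i ^^ t) (box_sum (p(i := 1)) e)) =
      (\<Sum>t<p i. \<Sum>s\<in>PiE {1..k} (\<lambda>j. {..<(p(i := 1)) j}). (\<phi> i ^^ t) (?c s))"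
    by (simp only: box_sum_def linear_sum[OF linear_funpow[OF assms(1)]])
  also have "\<dots> = (\<Sum>(t, s)\<in>{..<p i} \<times> PiE {1..k} (\<lambda>j. {..<(p(i := 1)) j}). (\<phi> i ^^ t) (?c s))"
    by (rule sum.cartesian_product)
  also have "\<dots> = box_sum p e"
    unfolding box_sum_def
  proof (rule sum.reindex_bij_witness[where i = "\<lambda>s. (s i, s(i := 0))" and j = "\<lambda>(t, s). s(i := t)"])
    fix z assume z: "z \<in> {..<p i} \<times> PiE {1..k} (\<lambda>j. {..<(p(i := 1)) j})"
    obtain t s where ts: "z = (t, s)" by (cases z)
    with z have t: "t < p i" and s: "s \<in> PiE {1..k} (\<lambda>j. {..<(p(i := 1)) j})" by auto
    have s0: "s i = 0" using PiE_mem[OF s assms(1)] by simp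
    then have upd: "s(i := 0) = s" by auto
    show "(\<lambda>s. (s i, s(i := 0))) ((\<lambda>(t, s). s(i := t)) z) = z"
      by (simp add: ts upd)
    show "(\<lambda>(t, s). s(i := t)) z \<in> PiE {1..k} (\<lambda>i. {..<p i})"
      using s t assms(1) by (auto simp: ts PiE_iff extensional_def split: if_splits)
    show "?c ((\<lambda>(t, s). s(i := t)) z) = (\<lambda>(t, s). (\<phi> i ^^ t) (?c s)) z"
      using pull[of "s(i := t)"] by (simp add: ts upd)
  next
    fix s assume s: "s \<in> PiE {1..k} (\<lambda>i. {..<p i})"
    then show "(s i, s(i := 0)) \<in> {..<p i} \<times> PiE {1..k} (\<lambda>j. {..<(p(i := 1)) j})"
      using assms(1) by (auto simp: PiE_iff extensional_def split: if_splits)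
    show "(\<lambda>(t, s). s(i := t)) (s i, s(i := 0)) = s" by simp
  qed
  finally show ?thesis by simp
qed

lemma telescope:
  assumes "i \<in> {1..k}"
  shows "\<phi> i (\<Sum>t<N. (\<phi> i ^^ t) y) - (\<Sum>t<N. (\<phi> i ^^ t) y) = (\<phi> i ^^ N) y - y"
  using sum_lessThan_telescope[of "\<lambda>t. (\<phi> i ^^ t) y" N]
  by (simp add: linear_sum[OF linear[OF assms]] sum_subtractf)

text \<open>Bounded averages force bounded powers:
  \<open>c * N * \<phi>\<^sup>N e \<le> \<phi>\<^sup>N (\<Sum>t<N. \<phi>\<^sup>t e) \<le> (\<Sum>t<2*N. \<phi>\<^sup>t e) \<le> 2 * d * N * e\<close>.\<close>

lemma box_sum_almost_invariant:
  assumes e: "0 \<le> e" and cd: "0 < c" "c \<le> d"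
    and lower: "\<And>p. (\<forall>i\<in>{1..k}. 1 \<le> p i) \<Longrightarrow> (c * real (\<Prod>i\<in>{1..k}. p i)) *\<^sub>R e \<le> box_sum p e"
    and upper: "\<And>p. (\<forall>i\<in>{1..k}. 1 \<le> p i) \<Longrightarrow> box_sum p e \<le> (d * real (\<Prod>i\<in>{1..k}. p i)) *\<^sub>R e"
    and i: "i \<in> {1..k}" and N: "1 \<le> N"
  shows "\<phi> i (box_sum (\<lambda>_. N) e) \<le> box_sum (\<lambda>_. N) e + (2 * d\<^sup>2 / c * real N ^ (k - 1)) *\<^sub>R e"
    and "box_sum (\<lambda>_. N) e \<le> \<phi> i (box_sum (\<lambda>_. N) e) + (2 * d\<^sup>2 / c * real N ^ (k - 1)) *\<^sub>R e"
proof -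
  have prod_upd: "(\<Prod>j\<in>{1..k}. ((\<lambda>_. L)(i := M)) j) = M * L ^ (k - 1)" for L M :: nat
  proof -
    have "(\<Prod>j\<in>{1..k} - {i}. ((\<lambda>_. L)(i := M)) j) = (\<Prod>j\<in>{1..k} - {i}. L)"
      by (rule prod.cong) auto
    then show ?thesis using i prod.remove[OF _ i, of "(\<lambda>_. L)(i := M)"] by simp
  qed
  have prod1: "(\<Prod>j\<in>{1..k}. ((\<lambda>_. 1)(i := M)) j) = M" for M :: nat
    unfolding prod_upd by simp
  have prodN: "(\<Prod>j\<in>{1..k}. ((\<lambda>_. N)(i := 1)) j) = N ^ (k - 1)"
    unfolding prod_upd by simp
  \<comment> \<open>Sides of length 1 off axis \<open>i\<close> reduce the hypotheses to averages of
    powers of the single map \<open>\<phi> i\<close>.\<close>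
  have box1: "box_sum ((\<lambda>_. 1)(i := M)) e = (\<Sum>t<M. (\<phi> i ^^ t) e)" for M
  proof -
    have "((\<lambda>_. 1 :: nat)(i := M))(i := 1) = (\<lambda>_. 1)" by auto
    then show ?thesis
      using box_sum_extract[OF i e, of "(\<lambda>_. 1)(i := M)"] box_sum_one by (simp only: fun_upd_same)
  qed
  note lin = linear_funpow[OF i]
  have power: "(\<phi> i ^^ N) e \<le> (2 * d / c) *\<^sub>R e"
  proof -
    have "(c * real N) *\<^sub>R (\<phi> i ^^ N) e = (\<phi> i ^^ N) ((c * real N) *\<^sub>R e)"
      by (simp only: linear_scale[OF lin])
    also have "\<dots> \<le> (\<phi> i ^^ N) (\<Sum>t<N. (\<phi> i ^^ t) e)"
      using lower[of "(\<lambda>_. 1)(i := N)"] N i unfolding prod1 box1 by (intro mono_funpow) auto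
    also have "\<dots> = (\<Sum>t<N. (\<phi> i ^^ (N + t)) e)"
      by (simp add: linear_sum[OF lin] funpow_add)
    also have "\<dots> \<le> (\<Sum>t<N. (\<phi> i ^^ t) e) + (\<Sum>t<N. (\<phi> i ^^ (N + t)) e)"
      by (simp add: sum_nonneg nonneg_funpow[OF i e])
    also have "\<dots> = (\<Sum>t<N + N. (\<phi> i ^^ t) e)"
      by (simp add: lessThan_atLeast0 sum.atLeastLessThan_concat[of 0 N "N + N", symmetric]
          sum.shift_bounds_nat_ivl[of _ 0 N N, simplified] add.commute)
    also have "\<dots> \<le> (d * real (N + N)) *\<^sub>R e"
      using upper[of "(\<lambda>_. 1)(i := N + N)"] N unfolding prod1 box1 by auto
    finally have "(1 / (c * real N)) *\<^sub>R (c * real N) *\<^sub>R (\<phi> i ^^ N) e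
        \<le> (1 / (c * real N)) *\<^sub>R (d * real (N + N)) *\<^sub>R e"
      by (rule scaleR_left_mono) (use cd in simp)
    moreover have "1 / (c * real N) * (d * real (N + N)) = 2 * d / c"
      using cd N by (simp add: field_simps)
    moreover have "1 / (c * real N) * (c * real N) = 1" using cd N by simp
    ultimately show ?thesis by (simp only: scaleR_scaleR scaleR_one)
  qed
  \<comment> \<open>\<open>V\<close> is the sum over the face \<open>s i = 0\<close>, which has
    \<open>P\<close> points. The factor \<open>2 * d\<^sup>2 / c\<close> is \<open>d\<close>, from
    \<open>V \<le> (d * P) *\<^sub>R e\<close>, times the power bound
    \<open>2 * d / c\<close>.\<close>
  define V where "V = box_sum ((\<lambda>_. N)(i := 1)) e"
  define P where "P = real N ^ (k - 1)"
  have P: "0 \<le> P" by (simp add: P_def)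
  have V: "(c * P) *\<^sub>R e \<le> V" "V \<le> (d * P) *\<^sub>R e"
    using lower[of "(\<lambda>_. N)(i := 1)"] upper[of "(\<lambda>_. N)(i := 1)"] N
    unfolding V_def[symmetric] prodN by (auto simp: P_def)
  have "0 \<le> (c * P) *\<^sub>R e" using cd P e by (simp add: scaleR_nonneg_nonneg)
  with V(1) have V0: "0 \<le> V" by simp
  have "(\<phi> i ^^ N) V \<le> (\<phi> i ^^ N) ((d * P) *\<^sub>R e)" by (rule mono_funpow[OF i V(2)])
  also have "\<dots> = (d * P) *\<^sub>R (\<phi> i ^^ N) e" by (simp only: linear_scale[OF lin])
  also have "\<dots> \<le> (d * P) *\<^sub>R ((2 * d / c) *\<^sub>R e)"
    using cd P by (intro scaleR_left_mono power) simp
  also have "\<dots> = (2 * d\<^sup>2 / c * P) *\<^sub>R e" by (simp add: power2_eq_square mult_ac)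
  finally have up: "(\<phi> i ^^ N) V \<le> (2 * d\<^sup>2 / c * P) *\<^sub>R e" .
  \<comment> \<open>By \<open>c \<le> d\<close> the same constant also dominates \<open>V\<close>.
    Each of the two differences is then bounded by dropping its positive subtracted term.\<close>
  have "d * P \<le> 2 * d\<^sup>2 / c * P"
    using cd by (intro mult_right_mono P) (simp add: field_simps power2_eq_square)
  then have V': "V \<le> (2 * d\<^sup>2 / c * P) *\<^sub>R e"
    using V(2) e scaleR_right_mono order_trans by blast
  have box: "box_sum (\<lambda>_. N) e = (\<Sum>t<N. (\<phi> i ^^ t) V)"
    unfolding V_def using box_sum_extract[OF i e, of "\<lambda>_. N"] by simp
  have tele: "\<phi> i (box_sum (\<lambda>_. N) e) - box_sum (\<lambda>_. N) e = (\<phi> i ^^ N) V - V"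
    unfolding box by (rule telescope[OF i])
  have "(\<phi> i ^^ N) V - V \<le> (2 * d\<^sup>2 / c * P) *\<^sub>R e" using up V0 by (simp add: diff_le_eq add_increasing2)
  then show "\<phi> i (box_sum (\<lambda>_. N) e) \<le> box_sum (\<lambda>_. N) e + (2 * d\<^sup>2 / c * real N ^ (k - 1)) *\<^sub>R e"
    unfolding tele[symmetric] P_def by (simp add: diff_le_eq add.commute)
  have "V - (\<phi> i ^^ N) V \<le> (2 * d\<^sup>2 / c * P) *\<^sub>R e"
    using V' nonneg_funpow[OF i V0, of N] by (simp add: diff_le_eq add_increasing2)
  moreover have "V - (\<phi> i ^^ N) V = box_sum (\<lambda>_. N) e - \<phi> i (box_sum (\<lambda>_. N) e)"
    using tele by (metis minus_diff_eq)
  ultimately show "box_sum (\<lambda>_. N) e \<le> \<phi> i (box_sum (\<lambda>_. N) e) + (2 * d\<^sup>2 / c * real N ^ (k - 1)) *\<^sub>R e"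
    unfolding P_def by (simp add: diff_le_eq add.commute)
qed

end

section \<open>Square roots and inverses\<close>

lemma bounded_linear_cinner_left: "bounded_linear (\<lambda>x. cinner x (y :: 'h::complex_hilbert_space))"
  by (rule bounded_linear_intro[where K = "norm y"])
    (simp_all add: cinner_add_left cinner_scaleR_left scaleR_conv_of_real Cauchy_Schwarz_cinner)

lemma bounded_linear_cinner_right: "bounded_linear (\<lambda>y. cinner (x :: 'h::complex_hilbert_space) y)"
  by (rule bounded_linear_intro[where K = "norm x"])
    (simp_all add: cinner_add_right cinner_scaleR_right scaleR_conv_of_real
      Cauchy_Schwarz_cinner mult.commute[of _ "norm x"])

text \<open>Substituting \<open>R = 1 - B\<close> turns \<open>R\<^sup>2 = 1 - X\<close> into the fixed point equation
  \<open>B = (X + B\<^sup>2) / 2\<close>, whose right-hand side contracts the ball of radius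
  \<open>r = 1 - sqrt (1 - norm X)\<close>.\<close>

lemma one_minus_square_root:
  fixes X :: "'h::complex_hilbert_space bop"
  assumes X: "0 \<le> X" "X \<le> q *\<^sub>R 1" and q: "0 < q" "q < 1"
  shows "\<exists>R. adj R = R \<and> R * R = 1 - X"
proof -
  define r where "r = 1 - sqrt (1 - q)"
  \<comment> \<open>\<open>r\<close> is the smaller root of \<open>(q + r * r) / 2 = r\<close>: the
    ball of radius \<open>r\<close> is mapped into itself, and \<open>r < 1\<close> serves as the
    contraction constant.\<close>
  have "q + r * r = 2 * r" using q by (simp add: r_def algebra_simps)
  with q have r: "0 \<le> r" "r < 1" "(q + r * r) / 2 = r" by (simp_all add: r_def)
  have Xb: "bounded_linear (bop_apply X)" using bop_apply[of X] by simp
  define x where "x = Blinfun (bop_apply X)"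
  have x: "blinfun_apply x = bop_apply X"
    unfolding x_def by (rule bounded_linear_Blinfun_apply[OF Xb])
  have "norm x \<le> q"
    by (rule norm_blinfun_bound) (use q positive_norm_le[OF X q(1)] x in auto)
  \<comment> \<open>\<open>blinfun\<close> supplies a complete norm but only real linearity. Complex
    linearity and symmetry are added as closed conditions that \<open>f\<close> preserves.\<close>
  define S where "S = {B :: 'h \<Rightarrow>\<^sub>L 'h. norm B \<le> r \<and>
      (\<forall>c u. blinfun_apply B (c *\<^sub>C u) = c *\<^sub>C blinfun_apply B u) \<and>
      (\<forall>u v. cinner (blinfun_apply B u) v = cinner u (blinfun_apply B v))}"
  define f where "f B = (1 / 2) *\<^sub>R (x + (B o\<^sub>L B))" for B
  have "closed S"
    unfolding S_def
    by (intro closed_Collect_conj closed_Collect_all closed_Collect_le closed_Collect_eq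
        continuous_intros bounded_linear.continuous_on[OF bounded_linear_scaleC]
        bounded_linear.continuous_on[OF bounded_linear_cinner_left]
        bounded_linear.continuous_on[OF bounded_linear_cinner_right])
  then have "complete S" by (simp add: complete_eq_closed)
  moreover have "0 \<in> S" by (simp add: S_def r)
  then have "S \<noteq> {}" by blast
  moreover have "f ` S \<subseteq> S"
  proof (rule image_subsetI)
    fix B assume B: "B \<in> S"
    have "norm (f B) \<le> (norm x + norm (B o\<^sub>L B)) / 2"
      unfolding f_def using norm_triangle_ineq[of x "B o\<^sub>L B"] by simp
    also have "norm (B o\<^sub>L B) \<le> norm B * norm B" by (rule norm_blinfun_compose)
    also have "norm B * norm B \<le> r * r" using B r by (intro mult_mono) (auto simp: S_def)
    finally have "norm (f B) \<le> r" using \<open>norm x \<le> q\<close> r(3) by simp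
    moreover have "blinfun_apply (f B) (c *\<^sub>C u) = c *\<^sub>C blinfun_apply (f B) u" for c u
      using B by (simp add: S_def f_def x blinfun.bilinear_simps bop_apply_scaleC
          scaleC_add_right scaleC_scaleR_commute)
    moreover have "cinner (bop_apply X u) v = cinner u (bop_apply X v)" for u v
      using cinner_adj_right[of X] adj_positive[OF X(1)] by simp
    then have "cinner (blinfun_apply (f B) u) v = cinner u (blinfun_apply (f B) v)" for u v
      using B by (simp add: S_def f_def x blinfun.bilinear_simps cinner_add_left cinner_add_right
          cinner_scaleR_left cinner_scaleR_right)
    ultimately show "f B \<in> S" by (simp add: S_def)
  qed
  moreover have "dist (f B) (f C) \<le> r * dist B C" if "B \<in> S" "C \<in> S" for B C
  proof -
    have "f B - f C = (1 / 2) *\<^sub>R ((B o\<^sub>L (B - C)) + ((B - C) o\<^sub>L C))"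
      by (rule blinfun_eqI) (simp add: f_def blinfun.bilinear_simps algebra_simps)
    then have "norm (f B - f C) = norm ((B o\<^sub>L (B - C)) + ((B - C) o\<^sub>L C)) / 2" by simp
    also have "\<dots> \<le> (norm (B o\<^sub>L (B - C)) + norm ((B - C) o\<^sub>L C)) / 2"
      using norm_triangle_ineq by (intro divide_right_mono) auto
    also have "\<dots> \<le> (norm B * norm (B - C) + norm (B - C) * norm C) / 2"
      by (intro divide_right_mono add_mono norm_blinfun_compose) simp
    also have "\<dots> \<le> (r * norm (B - C) + norm (B - C) * r) / 2"
      using that by (intro divide_right_mono add_mono mult_mono) (auto simp: S_def r)
    finally show ?thesis by (simp add: dist_norm mult.commute)
  qed
  ultimately obtain B where B: "B \<in> S" "f B = B"
    using Banach_fix[of S r f] r by blast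
  define R where "R = 1 - Abs_bop (blinfun_apply B)"
  have Bop: "bop_apply (Abs_bop (blinfun_apply B)) = blinfun_apply B"
    using B(1) by (intro Abs_bop_inverse) (simp add: S_def blinfun.bounded_linear_right)
  have R: "bop_apply R u = u - blinfun_apply B u" for u
    by (simp add: R_def bop_apply_simps Bop)
  have "adj R = R"
    using B(1) by (intro adj_unique) (simp add: R S_def cinner_diff_left cinner_diff_right)
  moreover have "R * R = 1 - X"
  proof (rule bop_eqI)
    fix u
    have "blinfun_apply B u = (1 / 2) *\<^sub>R (bop_apply X u + blinfun_apply B (blinfun_apply B u))"
      using arg_cong[OF B(2), of "\<lambda>B. blinfun_apply B u"]
      by (simp add: f_def x blinfun.bilinear_simps)
    from arg_cong[OF this, of "\<lambda>v. 2 *\<^sub>R v"]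
    have "2 *\<^sub>R blinfun_apply B u = bop_apply X u + blinfun_apply B (blinfun_apply B u)"
      by (simp only: scaleR_scaleR) simp
    then show "bop_apply (R * R) u = bop_apply (1 - X) u"
      by (simp add: R bop_apply_simps blinfun.bilinear_simps scaleR_2 algebra_simps)
  qed
  ultimately show ?thesis by blast
qed

text \<open>After division by a large \<open>D\<close>, the operator
  \<open>1 - (1 / D) *\<^sub>R Q\<close> is a strict positive contraction, so the preceding root
  applies to \<open>(1 / D) *\<^sub>R Q\<close>.\<close>

lemma positive_invertible_factorization:
  fixes Q :: "'h::complex_hilbert_space bop"
  assumes "0 \<le> Q" and "invertible_bop Q"
  shows "\<exists>R R'. R * adj R = Q \<and> R * R' = 1 \<and> R' * R = 1"
proof -
  obtain c where c: "0 < c" "c *\<^sub>R 1 \<le> Q"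
    using positive_invertible_bounded_below[OF assms] by blast
  obtain d where d: "0 < d" "Q \<le> d *\<^sub>R 1" using positive_le_scaleR_one[OF assms(1)] by blast
  \<comment> \<open>With \<open>c + d\<close> instead of \<open>d\<close>, the number
    \<open>1 - c / D\<close> lies strictly between 0 and 1.\<close>
  define D where "D = c + d"
  have D: "0 < D" using c d by (simp add: D_def)
  have "Q \<le> D *\<^sub>R 1"
    using c(1) by (intro order_trans[OF d(2)] scaleR_right_mono zero_le_one_bop) (simp add: D_def)
  then have "(1 / D) *\<^sub>R Q \<le> (1 / D) *\<^sub>R D *\<^sub>R 1" using D by (intro scaleR_left_mono) auto
  then have X0: "0 \<le> 1 - (1 / D) *\<^sub>R Q" using D by simp
  have "(1 / D) *\<^sub>R c *\<^sub>R 1 \<le> (1 / D) *\<^sub>R Q" using D by (intro scaleR_left_mono c(2)) auto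
  then have X1: "1 - (1 / D) *\<^sub>R Q \<le> (1 - c / D) *\<^sub>R 1"
    by (simp add: scaleR_diff_left)
  obtain R0 where R0: "adj R0 = R0" "R0 * R0 = 1 - (1 - (1 / D) *\<^sub>R Q)"
    using one_minus_square_root[OF X0 X1] c d D by (auto simp: D_def field_simps)
  define R where "R = sqrt D *\<^sub>R R0"
  have adj_R: "adj R = R"
    by (rule adj_unique)
      (metis R_def R0(1) cinner_adj_right scaleR_bop.rep_eq cinner_scaleR_left cinner_scaleR_right)
  have RR: "R * R = Q" using R0(2) D by (simp add: R_def)
  obtain Q' where Q': "Q' * Q = 1" "Q * Q' = 1" using assms(2) by (auto simp: invertible_bop_def)
  \<comment> \<open>From \<open>R * R = Q\<close> come a right inverse \<open>R * Q'\<close> and a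
    left inverse \<open>Q' * R\<close> of \<open>R\<close>, which then coincide.\<close>
  have right: "R * (R * Q') = 1" and left: "(Q' * R) * R = 1"
    using RR Q' by (simp_all add: mult.assoc[symmetric] RR) (simp add: mult.assoc RR)
  have "Q' * R = (Q' * R) * (R * (R * Q'))" using right by simp
  also have "\<dots> = R * Q'" using left by (simp add: mult.assoc[symmetric])
  finally have "(R * Q') * R = 1" using left by simp
  with right RR adj_R show ?thesis by metis
qed

text \<open>\<open>Q u = y\<close> is equivalent to the fixed point equation
  \<open>u = X u + (1 / D) *\<^sub>R y\<close>, where \<open>X = 1 - (1 / D) *\<^sub>R Q\<close>
  contracts by \<open>q < 1\<close>. Banach's theorem gives a unique solution for every
  \<open>y\<close>.\<close>

lemma bounded_below_imp_invertible:
  fixes Q :: "'h::complex_hilbert_space bop"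
  assumes c: "0 < c" "c \<le> d" and Q: "c *\<^sub>R 1 \<le> Q" "Q \<le> d *\<^sub>R 1"
  shows "invertible_bop Q"
proof -
  define D where "D = c + d"
  define q where "q = 1 - c / D"
  have D: "0 < D" "d \<le> D" using c by (simp_all add: D_def)
  have q: "0 < q" "q < 1" using c D by (simp_all add: q_def D_def)
  define X where "X = 1 - (1 / D) *\<^sub>R Q"
  have "Q \<le> D *\<^sub>R 1"
    by (intro order_trans[OF Q(2)] scaleR_right_mono zero_le_one_bop D)
  then have "(1 / D) *\<^sub>R Q \<le> (1 / D) *\<^sub>R D *\<^sub>R 1" using D by (intro scaleR_left_mono) auto
  then have X0: "0 \<le> X" using D by (simp add: X_def)
  have "(1 / D) *\<^sub>R c *\<^sub>R 1 \<le> (1 / D) *\<^sub>R Q" using D by (intro scaleR_left_mono Q(1)) auto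
  then have X1: "X \<le> q *\<^sub>R 1"
    by (simp add: X_def q_def scaleR_diff_left)
  have Xq: "norm (bop_apply X u) \<le> q * norm u" for u
    by (rule positive_norm_le[OF X0 X1 q(1)])
  have fix_iff: "bop_apply X u + (1 / D) *\<^sub>R y = u \<longleftrightarrow> bop_apply Q u = y" for u y
  proof -
    have "bop_apply X u + (1 / D) *\<^sub>R y = u \<longleftrightarrow> (1 / D) *\<^sub>R (y - bop_apply Q u) = 0"
      by (simp add: X_def bop_apply_simps scaleR_diff_right algebra_simps)
    then show ?thesis using D(1) by auto
  qed
  have ex1: "\<exists>!u. bop_apply Q u = y" for y
  proof -
    have "\<exists>!u. bop_apply X u + (1 / D) *\<^sub>R y = u"
    proof (rule banach_fix_type)
      show "\<forall>u v. dist (bop_apply X u + (1 / D) *\<^sub>R y) (bop_apply X v + (1 / D) *\<^sub>R y) \<le> q * dist u v"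
        using Xq by (simp add: dist_norm bop_apply_diff[symmetric])
    qed (use q in simp_all)
    then show ?thesis by (simp only: fix_iff)
  qed
  then obtain s where s: "\<And>y. bop_apply Q (s y) = y" by metis
  have s_eq: "s y = u" if "bop_apply Q u = y" for u y using ex1 s that by metis
  \<comment> \<open>The contraction estimate leaves the factor \<open>1 - q = c / D\<close>, hence
    the bound \<open>1 / c\<close> for the inverse.\<close>
  have s_bound: "norm (s y) \<le> norm y * (1 / c)" for y
  proof -
    have "norm (s y) \<le> norm (bop_apply X (s y)) + norm ((1 / D) *\<^sub>R y)"
      using fix_iff[of "s y" y] s norm_triangle_ineq by metis
    also have "\<dots> \<le> q * norm (s y) + norm y / D" using Xq[of "s y"] D(1) by simp
    finally have "(1 - q) * norm (s y) \<le> norm y / D" by (simp add: algebra_simps)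
    then show ?thesis using c D(1) by (simp add: q_def field_simps)
  qed
  have "bounded_linear s"
    by (rule bounded_linear_intro[OF _ _ s_bound])
      (rule s_eq, simp add: bop_apply_add bop_apply_scaleR s)+
  moreover have "s (c *\<^sub>C y) = c *\<^sub>C s y" for c y
    by (rule s_eq) (simp add: bop_apply_scaleC s)
  ultimately have S: "bop_apply (Abs_bop s) = s" by (simp add: Abs_bop_inverse)
  have "Abs_bop s * Q = 1" "Q * Abs_bop s = 1"
    by (rule bop_eqI, simp add: bop_apply_simps S s s_eq)+
  then show ?thesis unfolding invertible_bop_def by blast
qed

section \<open>Similarity\<close>

lemma prod_list_similar:
  assumes "R * R' = 1" and "R' * R = (1 :: 'b::monoid_mult)"
  shows "prod_list (map (\<lambda>i. R' * g i * R) xs) = R' * prod_list (map g xs) * R"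
proof (induction xs)
  case (Cons x xs)
  have "R' * g x * R * (R' * prod_list (map g xs) * R) = R' * g x * (R * R') * prod_list (map g xs) * R"
    by (simp only: mult.assoc)
  with Cons assms show ?case by (simp add: mult.assoc)
qed (simp add: assms)

lemma word_op_similar:
  assumes "R * R' = 1" and "R' * R = 1"
  shows "word_op (\<lambda>j. R' * X j * R) \<alpha> = R' * word_op X \<alpha> * R"
  unfolding word_op_def by (rule prod_list_similar[OF assms])

lemma word_op_cong:
  assumes "\<And>j. j \<in> {1..n} \<Longrightarrow> X j = X' j" and "\<alpha> \<in> words n"
  shows "word_op X \<alpha> = word_op X' \<alpha>"
  unfolding word_op_def
  by (rule arg_cong[of _ _ prod_list], rule map_cong[OF refl])
    (use assms in \<open>auto simp: words_def\<close>)

lemma scaleC_mult_left: "(c *\<^sub>C S) * T = c *\<^sub>C (S * (T :: 'h::complex_hilbert_space bop))"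
  by (rule bop_eqI) (simp add: bop_apply_simps)

lemma scaleC_mult_right: "S * (c *\<^sub>C T) = c *\<^sub>C (S * (T :: 'h::complex_hilbert_space bop))"
  by (rule bop_eqI) (simp add: bop_apply_simps bop_apply_scaleC)

lemma poly_eval_similar:
  assumes "R * R' = 1" and "R' * R = 1"
  shows "poly_eval k q (\<lambda>i j. R' * X i j * R) = R' * poly_eval k q X * R"
  unfolding poly_eval_def
  by (simp only: word_op_similar[OF assms] prod_list_similar[OF assms] sum_distrib_left
      sum_distrib_right scaleC_mult_left scaleC_mult_right)

text \<open>The similarity by \<open>R\<close> intertwines the two series: \<open>R * R'\<close>
  cancels to the left of \<open>Z\<close> and \<open>adj R' * adj R\<close> to its right. It
  transports fixed points in both directions between (i) and (iv).\<close>

lemma has_wot_sum_similar: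
  fixes R :: "'h::complex_hilbert_space bop"
  assumes sum: "has_wot_sum (\<lambda>\<alpha>. a \<alpha> *\<^sub>R (word_op X \<alpha> * Z * adj (word_op X \<alpha>))) (words n) S"
    and R: "R * R' = 1"
    and X': "\<And>\<alpha>. \<alpha> \<in> words n \<Longrightarrow> word_op X' \<alpha> = R' * word_op X \<alpha> * R"
  shows "has_wot_sum (\<lambda>\<alpha>. a \<alpha> *\<^sub>R (word_op X' \<alpha> * (R' * Z * adj R') * adj (word_op X' \<alpha>)))
    (words n) (R' * S * adj R')"
proof -
  have R_adj: "adj R' * adj R = 1" using R by (simp add: adj_mult[symmetric])
  have eq: "word_op X' \<alpha> * (R' * Z * adj R') * adj (word_op X' \<alpha>) =
      R' * (word_op X \<alpha> * Z * adj (word_op X \<alpha>)) * adj R'" if "\<alpha> \<in> words n" for \<alpha>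
  proof -
    have "word_op X' \<alpha> * (R' * Z * adj R') * adj (word_op X' \<alpha>) =
        R' * word_op X \<alpha> * (R * R') * Z * (adj R' * adj R) * adj (word_op X \<alpha>) * adj R'"
      by (simp only: X'[OF that] adj_mult mult.assoc)
    then show ?thesis by (simp add: R R_adj mult.assoc)
  qed
  have "limitin wot (\<lambda>F. \<Sum>\<alpha>\<in>F. R' * (a \<alpha> *\<^sub>R (word_op X \<alpha> * Z * adj (word_op X \<alpha>))) * adj R')
      (R' * S * adj R') (finite_subsets_at_top (words n))"
    using limitin_wot_mult[OF sum[unfolded has_wot_sum_def], of R' "adj R'"]
    by (simp only: sum_distrib_left sum_distrib_right)
  then show ?thesis
    by (subst has_wot_sum_cong) (auto simp: eq has_wot_sum_def)
qed

lemma linear_compose_upto: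
  assumes "\<And>i. i \<in> {1..k} \<Longrightarrow> linear (F i)"
  shows "linear (compose_upto k F)"
  using assms
proof (induction k)
  case (Suc k)
  have "compose_upto (Suc k) F = compose_upto k F \<circ> F (Suc k)"
    by (simp add: fun_eq_iff compose_upto_Suc)
  moreover have "linear (compose_upto k F \<circ> F (Suc k))"
    by (rule linear_compose) (use Suc in auto)
  ultimately show ?case by (simp only:)
qed (simp add: linear_id)

text \<open>Each factor \<open>id - \<Phi>\<close> sends 1 to 0 and 0 to 0, so no iterate leaves
  \<open>{0, 1}\<close>.\<close>

lemma Delta_nonneg_of_fixed_one:
  assumes "\<And>i. i \<in> {1..k} \<Longrightarrow> linear (Phi (n i) (a i) (X i))"
    and "\<And>i. i \<in> {1..k} \<Longrightarrow> Phi (n i) (a i) (X i) 1 = 1"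
  shows "0 \<le> Delta k n a X p (1 :: 'h::complex_hilbert_space bop)"
proof -
  have "Delta k n a X p 1 \<in> {0, 1}"
    unfolding Delta_def
  proof (rule compose_upto_in)
    fix i and y :: "'h bop" assume i: "i \<in> {1..k}" and y: "y \<in> {0, 1}"
    have "((\<lambda>Y. Y - Phi (n i) (a i) (X i) Y) ^^ t) y \<in> {0, 1}" for t
      by (induction t) (use y in \<open>auto simp: assms(2)[OF i] linear_0[OF assms(1)[OF i]]\<close>)
    then show "((\<lambda>Y. Y - Phi (n i) (a i) (X i) Y) ^^ p i) y \<in> {0, 1}" .
  qed simp
  then show ?thesis using zero_le_one_bop by auto
qed

section \<open>Fixed points of the maps \<open>\<Phi>\<close>\<close>

context
  fixes k :: nat and n :: "nat \<Rightarrow> nat" and a :: "nat \<Rightarrow> nat list \<Rightarrow> real"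
    and A :: "nat \<Rightarrow> nat \<Rightarrow> 'h::complex_hilbert_space bop"
  assumes coeff_nonneg: "\<And>i \<alpha>. i \<in> {1..k} \<Longrightarrow> \<alpha> \<in> words (n i) \<Longrightarrow> 0 \<le> a i \<alpha>"
    and cross: "cross_commuting k n A"
    and wd: "\<And>i. i \<in> {1..k} \<Longrightarrow> Phi_well_defined (n i) (a i) (A i)"
begin

interpretation commuting_positive_maps k "\<lambda>i. Phi (n i) (a i) (A i)"
proof (rule commuting_positive_maps.intro)
  show "linear (Phi (n i) (a i) (A i))" if "i \<in> {1..k}" for i
    by (intro linear_Phi coeff_nonneg wd that)
  show "0 \<le> Phi (n i) (a i) (A i) y" if "i \<in> {1..k}" "0 \<le> y" for i y
    by (intro Phi_nonneg coeff_nonneg wd that)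
  fix i j and y :: "'h bop" assume i: "i \<in> {1..k}" and j: "j \<in> {1..k}" and y: "0 \<le> y"
  show "Phi (n i) (a i) (A i) (Phi (n j) (a j) (A j) y) =
      Phi (n j) (a j) (A j) (Phi (n i) (a i) (A i) y)"
  \<comment> \<open>\<open>cross_commuting\<close> relates only different groups, and for
    \<open>i = j\<close> both sides are the same term.\<close>
  proof (cases "i = j")
    case False
    show ?thesis
      by (rule Phi_commute[OF coeff_nonneg[OF i] wd[OF i] coeff_nonneg[OF j] wd[OF j] _ y])
        (use cross False i j in \<open>auto simp: cross_commuting_def\<close>)
  qed simp
qed

lemma cesaro_mean_eq:
  "cesaro_mean k n a A p = (1 / real (\<Prod>i\<in>{1..k}. p i)) *\<^sub>R box_sum p 1"
  unfolding cesaro_mean_def box_sum_def ..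

lemma power_bounded_imp_means_bounded:
  assumes "power_bounded_between k n a A c d"
  shows "means_bounded_between k n a A c d"
  unfolding means_bounded_between_def
proof (intro allI impI)
  fix p :: "nat \<Rightarrow> nat" assume p: "\<forall>i\<in>{1..k}. 1 \<le> p i"
  let ?B = "PiE {1..k} (\<lambda>i. {..<p i})"
  let ?P = "real (\<Prod>i\<in>{1..k}. p i)"
  have card: "card ?B = (\<Prod>i\<in>{1..k}. p i)" by (simp add: card_PiE)
  have P: "0 < ?P" using p by (auto intro!: prod_pos)
  have bounds: "c *\<^sub>R 1 \<le> compose_downto k (\<lambda>i. Phi (n i) (a i) (A i) ^^ s i) 1"
    "compose_downto k (\<lambda>i. Phi (n i) (a i) (A i) ^^ s i) 1 \<le> d *\<^sub>R 1" for s
    using assms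
    unfolding power_bounded_between_def compose_upto_funpow_eq_downto[OF zero_le_one_bop] by blast+
  have sums: "(\<Sum>s\<in>?B. c *\<^sub>R 1) \<le> box_sum p 1" "box_sum p 1 \<le> (\<Sum>s\<in>?B. d *\<^sub>R 1)"
    unfolding box_sum_def by (rule sum_mono, rule bounds)+
  have const: "(1 / ?P) *\<^sub>R (\<Sum>s\<in>?B. r *\<^sub>R 1) = r *\<^sub>R (1 :: 'h bop)" for r
  proof -
    have "(1 / t) *\<^sub>R t *\<^sub>R r *\<^sub>R (1 :: 'h bop) = r *\<^sub>R 1" if "0 < t" for t :: real
      using that by simp
    from this[OF P] show ?thesis unfolding sum_constant_scaleR card .
  qed
  have inv: "0 \<le> 1 / ?P" using less_imp_le[OF P] by (simp only: zero_le_divide_1_iff)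
  show "c *\<^sub>R 1 \<le> cesaro_mean k n a A p \<and> cesaro_mean k n a A p \<le> d *\<^sub>R 1"
    using scaleR_left_mono[OF sums(1) inv] scaleR_left_mono[OF sums(2) inv]
    unfolding cesaro_mean_eq const by (rule conjI)
qed

text \<open>A composition \<open>U\<close> of powers is monotone and fixes \<open>Q\<close>.
  Applying it to \<open>c *\<^sub>R 1 \<le> Q \<le> d *\<^sub>R 1\<close> bounds \<open>U 1\<close>
  between \<open>c / d\<close> and \<open>d / c\<close>.\<close>

lemma fixed_point_imp_power_bounded:
  assumes Q: "0 \<le> Q" "invertible_bop Q" and fixed: "\<And>i. i \<in> {1..k} \<Longrightarrow> Phi (n i) (a i) (A i) Q = Q"
  shows "\<exists>c d. 0 < c \<and> c \<le> d \<and> power_bounded_between k n a A c d"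
proof -
  obtain c where c: "0 < c" "c *\<^sub>R 1 \<le> Q"
    using positive_invertible_bounded_below[OF Q] by blast
  obtain d0 where d0: "0 < d0" "Q \<le> d0 *\<^sub>R 1" using positive_le_scaleR_one[OF Q(1)] by blast
  \<comment> \<open>The sum secures \<open>c \<le> d\<close> by construction; on the zero space the
    operator inequalities would not compare \<open>c\<close> with \<open>d0\<close>.\<close>
  define d where "d = c + d0"
  have d: "c \<le> d" "0 < d" using c d0 by (simp_all add: d_def)
  have Qd: "Q \<le> d *\<^sub>R 1"
    using c(1) by (intro order_trans[OF d0(2)] scaleR_right_mono zero_le_one_bop) (simp add: d_def)
  have "power_bounded_between k n a A (c / d) (d / c)"
    unfolding power_bounded_between_def
  proof (rule allI)
    fix s :: "nat \<Rightarrow> nat"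
    let ?U = "compose_upto k (\<lambda>i. Phi (n i) (a i) (A i) ^^ s i)"
    have lin: "linear ?U" by (rule linear_compose_upto) (rule linear_funpow)
    have mono: "?U y \<le> ?U z" if "y \<le> z" for y z
    proof (rule positive_linear_mono[OF lin _ that])
      show "0 \<le> ?U x" if "0 \<le> x" for x
      proof -
        have "?U x \<in> {x. 0 \<le> x}"
        proof (rule compose_upto_in)
          show "(Phi (n i) (a i) (A i) ^^ s i) y \<in> {x. 0 \<le> x}"
            if "i \<in> {1..k}" "y \<in> {x. 0 \<le> x}" for i y
            using nonneg_funpow[OF that(1)] that(2) by blast
        qed (use that in simp)
        then show ?thesis by simp
      qed
    qed
    have pow: "(Phi (n i) (a i) (A i) ^^ t) Q = Q" if "i \<in> {1..k}" for i t
      by (induction t) (simp_all add: fixed[OF that])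
    have "?U Q \<in> {Q}"
    proof (rule compose_upto_in)
      show "(Phi (n i) (a i) (A i) ^^ s i) y \<in> {Q}" if "i \<in> {1..k}" "y \<in> {Q}" for i y
        using pow[OF that(1)] that(2) by simp
    qed simp
    then have UQ: "?U Q = Q" by simp
    have upper: "c *\<^sub>R ?U 1 \<le> d *\<^sub>R 1"
      using mono[OF c(2)] Qd unfolding linear_scale[OF lin] UQ by (rule order_trans)
    have lower: "c *\<^sub>R 1 \<le> d *\<^sub>R ?U 1"
      using c(2) mono[OF Qd] unfolding linear_scale[OF lin] UQ by (rule order_trans)
    have "(1 / c) *\<^sub>R c *\<^sub>R ?U 1 \<le> (1 / c) *\<^sub>R d *\<^sub>R 1"
      by (rule scaleR_left_mono[OF upper]) (use c(1) in simp)
    moreover have "(1 / d) *\<^sub>R c *\<^sub>R 1 \<le> (1 / d) *\<^sub>R d *\<^sub>R ?U 1"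
      by (rule scaleR_left_mono[OF lower]) (use d in simp)
    moreover have "1 / c * c = 1" "1 / d * d = 1" using c(1) d by simp_all
    ultimately show "(c / d) *\<^sub>R 1 \<le> ?U 1 \<and> ?U 1 \<le> (d / c) *\<^sub>R 1"
      by (simp only: scaleR_scaleR scaleR_one times_divide_eq_left mult_1_left simp_thms)
  qed
  moreover have "c / d \<le> 1" "1 \<le> d / c" using c(1) d by simp_all
  then have "c / d \<le> d / c" by linarith
  moreover have "0 < c / d" using c(1) d by simp
  ultimately show ?thesis by blast
qed

lemma means_bounded_imp_fixed_point:
  assumes cd: "0 < c" "c \<le> d" and means: "means_bounded_between k n a A c d"
  shows "\<exists>Q. 0 \<le> Q \<and> invertible_bop Q \<and> (\<forall>i\<in>{1..k}. Phi (n i) (a i) (A i) Q = Q) \<and>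
    Q \<in> generated_von_neumann_algebra (insert 1 {A i j | i j. i \<in> {1..k} \<and> j \<in> {1..n i}}) \<and>
    c *\<^sub>R 1 \<le> Q \<and> Q \<le> d *\<^sub>R 1"
proof -
  \<comment> \<open>Side \<open>Suc N\<close> keeps every cube nonempty, as the bounds on the means
    require.\<close>
  define M where "M N = cesaro_mean k n a A (\<lambda>_. Suc N)" for N
  define C where "C = 2 * d\<^sup>2 / c"
  have M: "c *\<^sub>R 1 \<le> M N" "M N \<le> d *\<^sub>R 1" for N
    using means unfolding means_bounded_between_def M_def by auto
  have M0: "0 \<le> M N" for N
    using order_trans[OF scaleR_nonneg_nonneg M(1)] cd(1) zero_le_one_bop by auto
  have box: "(c * real (\<Prod>i\<in>{1..k}. p i)) *\<^sub>R 1 \<le> box_sum p 1"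
    "box_sum p 1 \<le> (d * real (\<Prod>i\<in>{1..k}. p i)) *\<^sub>R 1" if p: "\<forall>i\<in>{1..k}. 1 \<le> p i" for p
  proof -
    let ?P = "real (\<Prod>i\<in>{1..k}. p i)"
    have P: "0 < ?P" using p by (auto intro!: prod_pos)
    have mean: "c *\<^sub>R 1 \<le> cesaro_mean k n a A p" "cesaro_mean k n a A p \<le> d *\<^sub>R 1"
      using means p unfolding means_bounded_between_def by blast+
    have "t * (1 / t) = 1" if "0 < t" for t :: real using that by simp
    then have "?P * (1 / ?P) = 1" using P by blast
    then have box: "?P *\<^sub>R cesaro_mean k n a A p = box_sum p 1"
      by (simp only: cesaro_mean_eq scaleR_scaleR scaleR_one)
    show "(c * ?P) *\<^sub>R 1 \<le> box_sum p 1" "box_sum p 1 \<le> (d * ?P) *\<^sub>R 1"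
      using scaleR_left_mono[OF mean(1) less_imp_le[OF P]] scaleR_left_mono[OF mean(2) less_imp_le[OF P]]
      unfolding box scaleR_scaleR by (simp_all only: mult.commute[of ?P])
  qed
  have almost: "Phi (n i) (a i) (A i) (M N) \<le> M N + (C / real (Suc N)) *\<^sub>R 1"
    "M N \<le> Phi (n i) (a i) (A i) (M N) + (C / real (Suc N)) *\<^sub>R 1" if i: "i \<in> {1..k}" for i N
  proof -
    let ?S = "box_sum (\<lambda>_. Suc N) 1" and ?r = "1 / real (Suc N) ^ k"
    let ?e = "(2 * d\<^sup>2 / c * real (Suc N) ^ (k - 1)) *\<^sub>R (1 :: 'h bop)"
    have MS: "M N = ?r *\<^sub>R ?S" by (simp add: M_def cesaro_mean_eq)
    \<comment> \<open>Here \<open>k\<close> is positive because \<open>i\<close> lies in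
      \<open>{1..k}\<close>, so one factor \<open>Suc N\<close> of the volume survives division by
      the face size.\<close>
    have "real (Suc N) ^ k = real (Suc N) * real (Suc N) ^ (k - 1)"
      using i by (simp add: power_eq_if)
    then have e: "?r *\<^sub>R ?e = (C / real (Suc N)) *\<^sub>R 1"
      by (simp add: C_def del: of_nat_Suc)
    have PM: "Phi (n i) (a i) (A i) (M N) = ?r *\<^sub>R Phi (n i) (a i) (A i) ?S"
      unfolding MS by (rule linear_scale[OF linear[OF i]])
    have N: "1 \<le> Suc N" by simp
    have ai: "Phi (n i) (a i) (A i) ?S \<le> ?S + ?e" "?S \<le> Phi (n i) (a i) (A i) ?S + ?e"
      by (rule box_sum_almost_invariant[OF zero_le_one_bop cd _ _ i N]; erule box)+
    have r: "0 \<le> ?r" by simp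
    show "Phi (n i) (a i) (A i) (M N) \<le> M N + (C / real (Suc N)) *\<^sub>R 1"
      using scaleR_left_mono[OF ai(1) r] by (simp only: PM scaleR_add_right e MS[symmetric])
    show "M N \<le> Phi (n i) (a i) (A i) (M N) + (C / real (Suc N)) *\<^sub>R 1"
      using scaleR_left_mono[OF ai(2) r] by (simp only: PM scaleR_add_right e MS[symmetric])
  qed
  have "0 < d" using cd by simp
  have "norm (bop_apply (M N) x) \<le> d * norm x" for N x
    by (rule positive_norm_le[OF M0 M(2) \<open>0 < d\<close>])
  from wot_cluster_point[of d M, OF less_imp_le[OF \<open>0 < d\<close>] this]
  obtain G Q where G: "G \<le> sequentially" "G \<noteq> bot" and Q: "limitin wot M Q G"
    by blast
  have "((\<lambda>N. C / real (Suc N)) \<longlongrightarrow> C * 0) G"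
    unfolding divide_inverse by (intro tendsto_mult tendsto_const tendsto_mono[OF G(1) LIMSEQ_inverse_real_of_nat])
  then have err: "limitin wot (\<lambda>N. (C / real (Suc N)) *\<^sub>R 1) (0 :: 'h bop) G"
    using limitin_wot_scaleR[of "\<lambda>_. 1" 1 G "\<lambda>N. C / real (Suc N)" 0] by simp
  have cQ: "c *\<^sub>R 1 \<le> Q"
    by (rule limitin_wot_le[OF G(2) _ Q, of "\<lambda>_. c *\<^sub>R 1"]) (simp_all add: M)
  have Qd: "Q \<le> d *\<^sub>R 1"
    by (rule limitin_wot_le[OF G(2) Q, of "\<lambda>_. d *\<^sub>R 1"]) (simp_all add: M)
  have Q0: "0 \<le> Q"
    using order_trans[OF scaleR_nonneg_nonneg cQ] cd(1) zero_le_one_bop by auto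
  have fixed: "Phi (n i) (a i) (A i) Q = Q" if i: "i \<in> {1..k}" for i
  proof (rule antisym)
    let ?\<phi> = "Phi (n i) (a i) (A i)"
    let ?f = "\<lambda>Y \<alpha>. a i \<alpha> *\<^sub>R (word_op (A i) \<alpha> * Y * adj (word_op (A i) \<alpha>))"
    note pos = coeff_nonneg[OF i] wd[OF i]
    \<comment> \<open>For fixed finite \<open>F\<close> the partial sum is weakly continuous, and
      along the sequence it lies below \<open>?\<phi> (y N)\<close>, hence below \<open>z N\<close>.
      Letting \<open>F\<close> grow only after the limit along \<open>G\<close> bounds
      \<open>?\<phi> Y\<close>.\<close>
    have Fatou: "?\<phi> Y \<le> Z"
      if Y: "limitin wot y Y G" "\<And>N. 0 \<le> y N" and Z: "limitin wot z Z G" "\<And>N. ?\<phi> (y N) \<le> z N"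
      for y z Y Z
    proof (rule Phi_leI[OF pos])
      fix F assume F: "finite F" "F \<subseteq> words (n i)"
      have "limitin wot (\<lambda>N. \<Sum>\<alpha>\<in>F. ?f (y N) \<alpha>) (\<Sum>\<alpha>\<in>F. ?f Y \<alpha>) G"
        by (intro limitin_wot_sum limitin_wot_scaleR limitin_wot_mult Y(1) tendsto_const)
      then show "(\<Sum>\<alpha>\<in>F. ?f Y \<alpha>) \<le> Z"
        by (rule limitin_wot_le[OF G(2) _ Z(1)])
          (intro always_eventually allI order_trans[OF Phi_partial_sum_le[OF pos Y(2) F] Z(2)])
    qed
    show "?\<phi> Q \<le> Q"
      by (rule Fatou[OF Q M0 _ almost(1)[OF i]])
        (use limitin_wot_add[OF Q err] in simp)
    \<comment> \<open>\<open>d *\<^sub>R 1 - M N\<close> is positive, and \<open>almost(2)\<close>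
      bounds its image from above. In the limit \<open>?\<phi> (d *\<^sub>R 1)\<close> cancels; the
      0 is the limit of the error term.\<close>
    have "?\<phi> (d *\<^sub>R 1 - Q) \<le> ?\<phi> (d *\<^sub>R 1) - (Q - 0)"
    proof (rule Fatou)
      show "limitin wot (\<lambda>N. d *\<^sub>R 1 - M N) (d *\<^sub>R 1 - Q) G"
        by (intro limitin_wot_diff Q) simp
      show "limitin wot (\<lambda>N. ?\<phi> (d *\<^sub>R 1) - (M N - (C / real (Suc N)) *\<^sub>R 1))
          (?\<phi> (d *\<^sub>R 1) - (Q - 0)) G"
        by (intro limitin_wot_diff Q err) simp
      show "?\<phi> (d *\<^sub>R 1 - M N) \<le> ?\<phi> (d *\<^sub>R 1) - (M N - (C / real (Suc N)) *\<^sub>R 1)" for N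
        unfolding linear_diff[OF linear[OF i]]
        by (rule diff_left_mono) (use almost(2)[OF i, of N] in \<open>simp only: diff_le_eq\<close>)
    qed (use M(2) in simp)
    then show "Q \<le> ?\<phi> Q" by (simp add: linear_diff[OF linear[OF i]])
  qed
  \<comment> \<open>Every mean lies in \<open>W\<close>, being built from 1 by the maps and linear
    combinations. Weak closedness of \<open>W\<close> then captures \<open>Q\<close>.\<close>
  have "Q \<in> W" if W: "von_neumann_algebra W"
    and AW: "insert 1 {A i j | i j. i \<in> {1..k} \<and> j \<in> {1..n i}} \<subseteq> W" for W
  proof (rule limitin_closedin[OF Q])
    show "closedin wot W" using W by (simp add: von_neumann_algebra_def)
    have Phi_W: "Phi (n i) (a i) (A i) y \<in> W" if "i \<in> {1..k}" "y \<in> W" for i y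
      by (rule Phi_in_von_neumann_algebra[OF coeff_nonneg[OF that(1)] wd[OF that(1)] W _ that(2)])
        (use AW that(1) in blast)+
    have "(Phi (n i) (a i) (A i) ^^ t) y \<in> W" if "i \<in> {1..k}" "y \<in> W" for i t y
      by (induction t) (simp_all add: that(2) Phi_W[OF that(1)])
    then have "compose_downto k (\<lambda>i. Phi (n i) (a i) (A i) ^^ s i) 1 \<in> W" for s
      using AW by (intro compose_downto_in) auto
    then have "box_sum p 1 \<in> W" for p
      unfolding box_sum_def by (intro von_neumann_algebra_sum[OF W])
    then have "M N \<in> W" for N
      using W unfolding M_def cesaro_mean_eq scaleC_of_real[symmetric] von_neumann_algebra_def
      by blast
    then show "eventually (\<lambda>N. M N \<in> W) G" by simp
  qed (rule G(2))
  then have "Q \<in> generated_von_neumann_algebra (insert 1 {A i j | i j. i \<in> {1..k} \<and> j \<in> {1..n i}})"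
    unfolding generated_von_neumann_algebra_def by blast
  with Q0 bounded_below_imp_invertible[OF cd cQ Qd] fixed cQ Qd show ?thesis by blast
qed

lemma fixed_point_imp_similar:
  assumes Q: "0 \<le> Q" "invertible_bop Q" and fixed: "\<And>i. i \<in> {1..k} \<Longrightarrow> Phi (n i) (a i) (A i) Q = Q"
    and zero: "\<forall>q\<in>\<Q>. poly_eval k q A = 0"
  shows "\<exists>T\<in>variety k n m a \<Q>. \<exists>Y Y'.
    (\<forall>i\<in>{1..k}. Phi (n i) (a i) (T i) 1 = 1) \<and> Y' * Y = 1 \<and> Y * Y' = 1 \<and>
    (\<forall>i\<in>{1..k}. \<forall>j\<in>{1..n i}. A i j = Y' * T i j * Y)"
proof -
  obtain R R' where R: "R * adj R = Q" "R * R' = 1" "R' * R = 1"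
    using positive_invertible_factorization[OF Q] by blast
  define T where "T i j = R' * A i j * R" for i j
  \<comment> \<open>The factorization is chosen so that conjugation by \<open>R'\<close> carries the
    fixed point \<open>Q\<close> to the fixed point 1.\<close>
  have "R' * Q * adj R' = (R' * R) * adj (R' * R)"
    by (simp add: R(1)[symmetric] adj_mult mult.assoc)
  then have RQ: "R' * Q * adj R' = 1" by (simp add: R(3))
  have sum: "has_wot_sum (\<lambda>\<alpha>. a i \<alpha> *\<^sub>R (word_op (T i) \<alpha> * 1 * adj (word_op (T i) \<alpha>))) (words (n i)) 1"
    if i: "i \<in> {1..k}" for i
  proof -
    have "word_op (T i) \<alpha> = R' * word_op (A i) \<alpha> * R" for \<alpha>
      unfolding T_def using word_op_similar[OF R(2,3)] .
    then show ?thesis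
      using has_wot_sum_similar[OF has_wot_sum_Phi[OF coeff_nonneg[OF i] wd[OF i], of Q] R(2), of "T i"]
      by (simp only: fixed[OF i] RQ)
  qed
  have Phi1: "Phi (n i) (a i) (T i) 1 = 1" if "i \<in> {1..k}" for i
    by (rule Phi_eqI[OF sum[OF that]])
  have wdT: "Phi_well_defined (n i) (a i) (T i)" if "i \<in> {1..k}" for i
    using sum[OF that] unfolding Phi_well_defined_def by auto
  have prodT: "T s j * T t l = R' * (A s j * A t l) * R" for s j t l
  proof -
    have "T s j * T t l = R' * A s j * (R * R') * A t l * R"
      unfolding T_def by (simp only: mult.assoc)
    then show ?thesis by (simp add: R(2) mult.assoc)
  qed
  have "cross_commuting k n T"
    using cross unfolding cross_commuting_def prodT by simp
  moreover have "0 \<le> Delta k n a T p 1" for p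
    by (rule Delta_nonneg_of_fixed_one) (use linear_Phi[OF coeff_nonneg wdT] Phi1 in auto)
  ultimately have "T \<in> polydomain k n m a"
    using wdT by (simp add: polydomain_def)
  moreover have "poly_eval k q T = 0" if "q \<in> \<Q>" for q
    using poly_eval_similar[OF R(2,3), of k q A] zero that unfolding T_def by simp
  ultimately have "T \<in> variety k n m a \<Q>" by (simp add: variety_def)
  moreover have "A i j = R * T i j * R'" for i j
  proof -
    have "R * T i j * R' = (R * R') * A i j * (R * R')" unfolding T_def by (simp only: mult.assoc)
    then show ?thesis by (simp add: R)
  qed
  ultimately show ?thesis
    \<comment> \<open>Undoing the conjugation gives \<open>A i j = R * T i j * R'\<close>, so
      \<open>Y\<close> is \<open>R'\<close> and its inverse is \<open>R\<close>.\<close>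
    by (intro bexI[of _ T] exI[of _ R'] exI[of _ R]) (simp_all add: Phi1 R(2,3))
qed

text \<open>The fixed point is 1 transported back by the similarity, \<open>Q = Y' * adj Y'\<close>,
  with inverse \<open>adj Y * Y\<close>. The middle factor 1 is kept so that the term matches
  \<open>has_wot_sum_similar\<close> at \<open>Z = 1\<close>.\<close>

lemma similar_imp_fixed_point:
  assumes T: "T \<in> variety k n m a \<Q>" "\<And>i. i \<in> {1..k} \<Longrightarrow> Phi (n i) (a i) (T i) 1 = 1"
    and Y: "Y' * Y = 1" "Y * Y' = 1"
    and A: "\<And>i j. i \<in> {1..k} \<Longrightarrow> j \<in> {1..n i} \<Longrightarrow> A i j = Y' * T i j * Y"
  shows "\<exists>Q. 0 \<le> Q \<and> invertible_bop Q \<and> (\<forall>i\<in>{1..k}. Phi (n i) (a i) (A i) Q = Q)"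
proof (intro exI conjI ballI)
  have wdT: "Phi_well_defined (n i) (a i) (T i)" if "i \<in> {1..k}" for i
    using T(1) that by (simp add: variety_def polydomain_def)
  show "0 \<le> Y' * 1 * adj Y'" using conjugate_mono[OF zero_le_one_bop, of Y'] by simp
  have "adj Y * Y * (Y' * 1 * adj Y') = adj Y * (Y * Y') * adj Y'"
    and "Y' * 1 * adj Y' * (adj Y * Y) = Y' * (adj Y' * adj Y) * Y"
    by (simp_all add: mult.assoc)
  then have "adj Y * Y * (Y' * 1 * adj Y') = 1" "Y' * 1 * adj Y' * (adj Y * Y) = 1"
    by (simp_all add: Y adj_mult[symmetric])
  then show "invertible_bop (Y' * 1 * adj Y')" unfolding invertible_bop_def by blast
  fix i assume i: "i \<in> {1..k}"
  have "word_op (A i) \<alpha> = Y' * word_op (T i) \<alpha> * Y" if "\<alpha> \<in> words (n i)" for \<alpha>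
    using word_op_cong[OF A[OF i] that] word_op_similar[OF Y(2,1), of "T i"] by simp
  then show "Phi (n i) (a i) (A i) (Y' * 1 * adj Y') = Y' * 1 * adj Y'"
    using has_wot_sum_similar[OF has_wot_sum_Phi[OF coeff_nonneg[OF i] wdT[OF i], of 1] Y(2), of "A i"]
    by (intro Phi_eqI) (simp only: T(2)[OF i])
qed

end
theorem theorem4p1:
  fixes k :: nat and n m :: "nat \<Rightarrow> nat"
    and a :: "nat \<Rightarrow> nat list \<Rightarrow> real"
    and \<Q> :: "((nat \<Rightarrow> nat list) \<Rightarrow>\<^sub>0 complex) set"
    and A :: "nat \<Rightarrow> nat \<Rightarrow> 'h::complex_hilbert_space bop"
  assumes "separable_space (euclidean :: 'h topology)"
    and "1 \<le> k"
    and "\<forall>i\<in>{1..k}. 1 \<le> n i \<and> 1 \<le> m i"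
    and "\<forall>i\<in>{1..k}. positive_regular (n i) (a i)"
    and "\<Q> \<subseteq> polynomials k n"
    and "cross_commuting k n A"
    and "\<forall>i\<in>{1..k}. Phi_well_defined (n i) (a i) (A i)"
    and "\<forall>q\<in>\<Q>. poly_eval k q A = 0"
  shows
    "((\<exists>T\<in>variety k n m a \<Q>. \<exists>Y Y'.
          (\<forall>i\<in>{1..k}. Phi (n i) (a i) (T i) 1 = 1) \<and>
          Y' * Y = 1 \<and> Y * Y' = 1 \<and>
          (\<forall>i\<in>{1..k}. \<forall>j\<in>{1..n i}. A i j = Y' * T i j * Y))
        \<longleftrightarrow> (\<exists>c d. 0 < c \<and> c \<le> d \<and> power_bounded_between k n a A c d))
     \<and>
      ((\<exists>c d. 0 < c \<and> c \<le> d \<and> power_bounded_between k n a A c d)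
        \<longleftrightarrow> (\<exists>c d. 0 < c \<and> c \<le> d \<and> means_bounded_between k n a A c d))
     \<and>
      ((\<exists>c d. 0 < c \<and> c \<le> d \<and> means_bounded_between k n a A c d)
        \<longleftrightarrow> (\<exists>Q. 0 \<le> Q \<and> invertible_bop Q \<and> (\<forall>i\<in>{1..k}. Phi (n i) (a i) (A i) Q = Q)))
     \<and>
      (\<forall>c d. 0 < c \<and> c \<le> d \<and>
          (power_bounded_between k n a A c d \<or> means_bounded_between k n a A c d) \<longrightarrow>
        (\<exists>Q. 0 \<le> Q \<and> invertible_bop Q \<and> (\<forall>i\<in>{1..k}. Phi (n i) (a i) (A i) Q = Q) \<and>
             Q \<in> generated_von_neumann_algebra
                   (insert 1 {A i j | i j. i \<in> {1..k} \<and> j \<in> {1..n i}}) \<and>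
             c *\<^sub>R 1 \<le> Q \<and> Q \<le> d *\<^sub>R 1))"
proof -
  have nonneg: "0 \<le> a i \<alpha>" if "i \<in> {1..k}" "\<alpha> \<in> words (n i)" for i \<alpha>
    using assms(4) that unfolding positive_regular_def by blast
  have wd: "Phi_well_defined (n i) (a i) (A i)" if "i \<in> {1..k}" for i
    using assms(7) that by blast
  note ctx = nonneg assms(6) wd
  let ?i = "\<exists>T\<in>variety k n m a \<Q>. \<exists>Y Y'.
      (\<forall>i\<in>{1..k}. Phi (n i) (a i) (T i) 1 = 1) \<and> Y' * Y = 1 \<and> Y * Y' = 1 \<and>
      (\<forall>i\<in>{1..k}. \<forall>j\<in>{1..n i}. A i j = Y' * T i j * Y)"
  let ?ii = "\<exists>c d. 0 < c \<and> c \<le> d \<and> power_bounded_between k n a A c d"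
  let ?iii = "\<exists>c d. 0 < c \<and> c \<le> d \<and> means_bounded_between k n a A c d"
  let ?iv = "\<exists>Q. 0 \<le> Q \<and> invertible_bop Q \<and> (\<forall>i\<in>{1..k}. Phi (n i) (a i) (A i) Q = Q)"
  have i_iv: ?iv if ?i
  proof -
    from that obtain T Y Y' where T: "T \<in> variety k n m a \<Q>"
        "\<And>i. i \<in> {1..k} \<Longrightarrow> Phi (n i) (a i) (T i) 1 = 1"
      and Y: "Y' * Y = 1" "Y * Y' = 1"
      and A: "\<And>i j. i \<in> {1..k} \<Longrightarrow> j \<in> {1..n i} \<Longrightarrow> A i j = Y' * T i j * Y"
      by blast
    show ?thesis by (rule similar_imp_fixed_point[OF ctx T Y A])
  qed
  have iv_i: ?i if ?iv
  proof -
    from that obtain Q where Q: "0 \<le> Q" "invertible_bop Q"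
      "\<And>i. i \<in> {1..k} \<Longrightarrow> Phi (n i) (a i) (A i) Q = Q" by blast
    show ?thesis by (rule fixed_point_imp_similar[OF ctx Q assms(8)])
  qed
  have iv_ii: ?ii if ?iv
  proof -
    from that obtain Q where Q: "0 \<le> Q" "invertible_bop Q"
      "\<And>i. i \<in> {1..k} \<Longrightarrow> Phi (n i) (a i) (A i) Q = Q" by blast
    show ?thesis by (rule fixed_point_imp_power_bounded[OF ctx Q])
  qed
  have ii_iii: "means_bounded_between k n a A c d" if "power_bounded_between k n a A c d" for c d
    by (rule power_bounded_imp_means_bounded[OF ctx that])
  have moreover_part: "\<exists>Q. 0 \<le> Q \<and> invertible_bop Q \<and> (\<forall>i\<in>{1..k}. Phi (n i) (a i) (A i) Q = Q) \<and>
      Q \<in> generated_von_neumann_algebra (insert 1 {A i j | i j. i \<in> {1..k} \<and> j \<in> {1..n i}}) \<and>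
      c *\<^sub>R 1 \<le> Q \<and> Q \<le> d *\<^sub>R 1"
    if "0 < c" "c \<le> d" "means_bounded_between k n a A c d" for c d
    by (rule means_bounded_imp_fixed_point[OF ctx that])
  have ii_imp_iii: ?iii if ?ii using that ii_iii by blast
  have iii_iv: ?iv if ?iii
  proof -
    from that obtain c d where "0 < c" "c \<le> d" "means_bounded_between k n a A c d" by blast
    from moreover_part[OF this] show ?thesis by blast
  qed
  have "?i \<longleftrightarrow> ?ii" using i_iv iv_i iv_ii ii_imp_iii iii_iv by argo
  moreover have "?ii \<longleftrightarrow> ?iii" using iv_ii ii_imp_iii iii_iv by argo
  moreover have "?iii \<longleftrightarrow> ?iv" using iv_ii ii_imp_iii iii_iv by argo
  moreover have "\<forall>c d. 0 < c \<and> c \<le> d \<and>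
      (power_bounded_between k n a A c d \<or> means_bounded_between k n a A c d) \<longrightarrow>
      (\<exists>Q. 0 \<le> Q \<and> invertible_bop Q \<and> (\<forall>i\<in>{1..k}. Phi (n i) (a i) (A i) Q = Q) \<and>
        Q \<in> generated_von_neumann_algebra (insert 1 {A i j | i j. i \<in> {1..k} \<and> j \<in> {1..n i}}) \<and>
        c *\<^sub>R 1 \<le> Q \<and> Q \<le> d *\<^sub>R 1)"
  proof (intro allI impI, elim conjE)
    fix c d :: real
    assume cd: "0 < c" "c \<le> d"
      and "power_bounded_between k n a A c d \<or> means_bounded_between k n a A c d"
    then have "means_bounded_between k n a A c d" using ii_iii by (elim disjE)
    from moreover_part[OF cd this]
    show "\<exists>Q. 0 \<le> Q \<and> invertible_bop Q \<and> (\<forall>i\<in>{1..k}. Phi (n i) (a i) (A i) Q = Q) \<and>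
        Q \<in> generated_von_neumann_algebra (insert 1 {A i j | i j. i \<in> {1..k} \<and> j \<in> {1..n i}}) \<and>
        c *\<^sub>R 1 \<le> Q \<and> Q \<le> d *\<^sub>R 1" .
  qed
  ultimately show ?thesis by (intro conjI)
qed

end
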